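(* Let $(\mathbb X,d)$ be a compact metric space, let $m\ge k\ge1$ be integers, $p\ge1$, and let $\alpha_1,\dots,\alpha_m$ be Borel probability measures on $\mathbb X$. For each $n$ and $1\le i\le m$ let $\mathbb X_n^i$ consist of $n$ i.i.d. samples $X^i_1,\dots,X^i_n$ drawn from $\alpha_i$ and put $\mathbb X_n=\bigcup_{i=1}^m\mathbb X_n^i$. Let $d_n$ be any consistent estimator of the ground metric $d$, i.e. (random) metrics $d_n$ on $\mathbb X_n$ such that, almost surely, $(\mathbb X_n,d_n)$ converges to $(\mathbb X,d)$ in the Gromov–Hausdorff sense, the convergence being realized by the inclusions $\mathbb X_n\hookrightarrow\mathbb X$. Let $d_W^{(n)}$ be the $L^2$-Wasserstein distance on $\mathcal P(\mathbb X_n)$ computed from $d_n$ and $d_W$ the $L^2$-Wasserstein distance on $\mathcal P(\mathbb X)$ computed from $d$. Let $\widehat\alpha_i\in\mathcal P(\mathbb X_n)$ be the empirical measure of $\mathbb X_n^i$, let $\mu_n=\frac1m\sum_{i=1}^m\delta_{\widehat\alpha_i}\in\mathcal P(\mathcal P(\mathbb X_n))$ and $\mu=\frac1m\sum_{i=1}^m\delta_{\alpha_i}\in\mathcal P(\mathcal P(\mathbb X))$. Then, almost surely: for every $\varepsilon>0$ there exists $N\in\mathbb N$ such that for all $n\ge N$ and every set of $k$-barycenters $S_n\in\mathcal S_{\mathcal X_n}(k)$ of $\mathcal X_n=(\mathcal P(\mathbb X_n),d_W^{(n)},\mu_n)$ there exists a set of $k$-barycenters $S\in\mathcal S_{\mathcal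 X}(k)$ of $\mathcal X=(\mathcal P(\mathbb X),d_W,\mu)$ with $$d_H(S_n,S)\le\varepsilon,$$ where $d_H$ is the Hausdorff distance between subsets of $(\mathcal P(\mathbb X),d_W)$, and measures on $\mathbb X_n\subset\mathbb X$ are viewed as measures on $\mathbb X$.
   Context: $\mathcal P(\mathbb Y)$ is the set of Borel probability measures on $\mathbb Y$; the $L^2$-Wasserstein distance for a ground metric $\rho$ is $\left(\inf_\pi\int\rho(x,y)^2\,\pi(dx,dy)\right)^{1/2}$ over couplings $\pi$. The empirical measure is $\widehat\alpha_i=\frac1n\sum_{j=1}^n\delta_{X^i_j}$. That the Gromov–Hausdorff convergence is realized by the inclusions means that the inclusion $\mathbb X_n\to\mathbb X$ is an $\varepsilon_n$-isometry from $(\mathbb X_n,d_n)$ to $(\mathbb X,d)$ with $\varepsilon_n\to0$: $|d_n(x,x')-d(x,x')|<\varepsilon_n$ for all $x,x'\in\mathbb X_n$, and $\min_{x\in\mathbb X_n}d(y,x)<\varepsilon_n$ for all $y\in\mathbb X$. For a compact metric space with probability measure $\mathcal Y=(\mathbb Y,\rho,\nu)$, $C_k(\mathbb Y)$ is the set of nonempty subsets of $\mathbb Y$ with at most $k$ elements, and $\mathcal S_{\mathcal Y}(k)$ (sets of $k$-means, or $k$-barycenters) is the set of minimizers over $S\in C_k(\mathbb Y)$ of $\int_{\mathbb Y}\min_{x\in S}\rho(y,x)^p\,\nu(dy)$. $d_H(A,B)=\max\{\max_{a\in A}\rho(a,B),\max_{b\in B}\rho(b,A)\}$. *)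

theory Defs
  imports "HOL-Probability.Probability"
begin

definition metric_borel :: "'b set \<Rightarrow> ('b \<Rightarrow> 'b \<Rightarrow> real) \<Rightarrow> 'b measure" where
  "metric_borel Y \<rho> = sigma Y {U. openin (Metric_space.mtopology Y \<rho>) U}"

lemma metric_borel_UNIV_dist:
  "metric_borel (UNIV :: 'a::metric_space set) dist = borel"
proof -
  have "Metric_space.mtopology (UNIV :: 'a set) dist = euclidean"
    by (rule mtopology_is_euclidean)
  then show ?thesis
    by (simp add: metric_borel_def borel_def)
qed

definition prob_measures :: "'b set \<Rightarrow> ('b \<Rightarrow> 'b \<Rightarrow> real) \<Rightarrow> 'b measure set" where
  "prob_measures Y \<rho> =
     {\<nu>. prob_space \<nu> \<and> space \<nu> = Y \<and> sets \<nu> = sets (metric_borel Y \<rho>)}"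

text \<open>For the second countable spaces considered here, the product sigma-algebra used for
  couplings is the Borel sigma-algebra of the product space.\<close>

definition couplings :: "'b measure \<Rightarrow> 'b measure \<Rightarrow> ('b \<times> 'b) measure set" where
  "couplings \<mu> \<nu> =
     {\<pi>. sets \<pi> = sets (\<mu> \<Otimes>\<^sub>M \<nu>) \<and> distr \<pi> \<mu> fst = \<mu> \<and> distr \<pi> \<nu> snd = \<nu>}"

definition wasserstein2 ::
    "('b \<Rightarrow> 'b \<Rightarrow> real) \<Rightarrow> 'b measure \<Rightarrow> 'b measure \<Rightarrow> real" where
  "wasserstein2 \<rho> \<mu> \<nu> =
     sqrt (enn2real (INF \<pi> \<in> couplings \<mu> \<nu>. \<integral>\<^sup>+ z. ennreal ((\<rho> (fst z) (snd z))\<^sup>2) \<partial>\<pi>))"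

text \<open>The measure $\frac1n \sum_{j=1}^n \delta_{x_j}$ on the measurable space \<open>B\<close>.\<close>

definition dirac_average :: "'b measure \<Rightarrow> nat \<Rightarrow> (nat \<Rightarrow> 'b) \<Rightarrow> 'b measure" where
  "dirac_average B n x =
     measure_of (space B) (sets B)
       (\<lambda>A. (\<Sum>j=1..n. emeasure (return B (x j)) A) / ennreal (real n))"

lemma emeasure_dirac_average:
  assumes "A \<in> sets B"
  shows "emeasure (dirac_average B n x) A =
    (\<Sum>j=1..n. emeasure (return B (x j)) A) / ennreal (real n)"
proof -
  let ?f = "\<lambda>A. (\<Sum>j=1..n. emeasure (return B (x j)) A) / ennreal (real n)"
  have "countably_additive (sets B) ?f"
  proof (rule countably_additiveI)
    fix F :: "nat \<Rightarrow> 'a set"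
    assume F: "range F \<subseteq> sets B" "disjoint_family F"
    have "(\<Sum>i. emeasure (return B (x j)) (F i)) = emeasure (return B (x j)) (\<Union>i. F i)" for j
      using F by (intro suminf_emeasure) auto
    then show "(\<Sum>i. ?f (F i)) = ?f (\<Union>i. F i)"
      by (simp add: divide_ennreal_def ennreal_suminf_multc suminf_sum)
  qed
  then show ?thesis
    using assms unfolding dirac_average_def
    by (intro emeasure_measure_of_sigma sets.sigma_algebra_axioms) (auto simp: positive_def)
qed

definition finite_subsets_upto :: "'b set \<Rightarrow> nat \<Rightarrow> 'b set set" where
  "finite_subsets_upto Y k = {S. S \<subseteq> Y \<and> S \<noteq> {} \<and> finite S \<and> card S \<le> k}"

definition kmeans_cost ::
    "('b \<Rightarrow> 'b \<Rightarrow> real) \<Rightarrow> 'b measure \<Rightarrow> real \<Rightarrow> 'b set \<Rightarrow> ennreal" where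
  "kmeans_cost \<rho> \<nu> p S = (\<integral>\<^sup>+ y. ennreal (Min ((\<lambda>x. \<rho> y x powr p) ` S)) \<partial>\<nu>)"

definition kmeans_sets ::
    "'b set \<Rightarrow> ('b \<Rightarrow> 'b \<Rightarrow> real) \<Rightarrow> 'b measure \<Rightarrow> real \<Rightarrow> nat \<Rightarrow> 'b set set" where
  "kmeans_sets Y \<rho> \<nu> p k =
     {S \<in> finite_subsets_upto Y k.
        \<forall>T \<in> finite_subsets_upto Y k. kmeans_cost \<rho> \<nu> p S \<le> kmeans_cost \<rho> \<nu> p T}"

text \<open>Sets of \<open>k\<close>-barycenters of $(\mathcal{P}(Y), W_2, \frac1m \sum_{i=1}^m \delta_{\alpha_i})$,
  where $W_2$ is computed from the ground metric \<open>\<rho>\<close>.\<close>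

definition wasserstein_barycenter_sets ::
    "'b set \<Rightarrow> ('b \<Rightarrow> 'b \<Rightarrow> real) \<Rightarrow> nat \<Rightarrow> (nat \<Rightarrow> 'b measure) \<Rightarrow> real \<Rightarrow> nat
      \<Rightarrow> 'b measure set set" where
  "wasserstein_barycenter_sets Y \<rho> m \<alpha> p k =
     kmeans_sets (prob_measures Y \<rho>) (wasserstein2 \<rho>)
       (dirac_average (metric_borel (prob_measures Y \<rho>) (wasserstein2 \<rho>)) m \<alpha>) p k"

text \<open>Only applied to nonempty finite sets, for which the suprema and infima are attained.\<close>

definition hausdorff_distance :: "('b \<Rightarrow> 'b \<Rightarrow> real) \<Rightarrow> 'b set \<Rightarrow> 'b set \<Rightarrow> real" where
  "hausdorff_distance \<rho> A B =
     max (SUP a\<in>A. INF b\<in>B. \<rho> a b) (SUP b\<in>B. INF a\<in>A. \<rho> b a)"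

text \<open>Gromov--Hausdorff convergence of finite spaces \<open>(Y n, \<rho> n)\<close>, \<open>Y n\<close> a nonempty finite
  subset of the ambient space, realized by the inclusions.  The index \<open>n = 0\<close> is excluded,
  since a sample of size \<open>0\<close> is empty.\<close>

definition GH_converges_by_inclusion ::
    "(nat \<Rightarrow> 'a::metric_space set) \<Rightarrow> (nat \<Rightarrow> 'a \<Rightarrow> 'a \<Rightarrow> real) \<Rightarrow> bool" where
  "GH_converges_by_inclusion Y \<rho> \<longleftrightarrow>
     (\<exists>\<epsilon> :: nat \<Rightarrow> real. \<epsilon> \<longlonglongrightarrow> 0 \<and>
        (\<forall>n\<ge>1. (\<forall>x\<in>Y n. \<forall>x'\<in>Y n. \<bar>\<rho> n x x' - dist x x'\<bar> < \<epsilon> n) \<and>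
                (\<forall>y. Min ((\<lambda>x. dist y x) ` Y n) < \<epsilon> n)))"

definition sample_set :: "nat \<Rightarrow> (nat \<Rightarrow> nat \<Rightarrow> 'w \<Rightarrow> 'a) \<Rightarrow> nat \<Rightarrow> 'w \<Rightarrow> 'a set" where
  "sample_set m X n \<omega> = (\<Union>i\<in>{1..m}. (\<lambda>j. X i j \<omega>) ` {1..n})"

end

theory Submission
  imports Defs
begin

text \<open>
  The triangle inequality for \<open>W\<^sub>2\<close> needs no disintegration: on a totally bounded space two couplings
  with a common marginal can be glued over a finite partition into cells of small diameter, at the
  cost of that diameter.

  A compact metric space \<open>X\<close> has a Borel coding \<open>s : X \<rightarrow> [0, 1]\<close> whose inverse extends continuously
  to the closure of its range. If the pushforwards under \<open>s\<close> of probability measures on \<open>X\<close> converge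
  weakly, Skorohod's theorem gives almost surely convergent representatives on the line, and mapping
  them back to \<open>X\<close> couples the measures and gives \<open>W\<^sub>2\<close>-convergence. With Helly's theorem this proves
  that the space of probability measures is sequentially compact; with Hoeffding's inequality and
  Borel-Cantelli for the distribution functions at rational points it proves that empirical measures
  converge almost surely.

  Along a sequence of \<open>k\<close>-barycenter sets of the approximating spaces one therefore finds convergent
  subsequences of the \<open>k\<close> members. The costs converge along with them, and every competitor in the
  limit space is approximated by competitors in the approximating spaces, so the limit is a set of
  \<open>k\<close>-barycenters. A sequence that stays away from all of these in the Hausdorff distance is impossible.
\<close>

subsection \<open>A coding of compact metric spaces by reals\<close>

text \<open>Only the inverse of the coding is continuous, and that is enough: weak convergence is
  always established for the coded measures on the line and never carried from \<open>X\<close> to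
  the line, so the jumps of \<open>s\<close> do no harm. The sample set, its metric and its
  sigma-algebra vary with \<open>n\<close>. Pushing forward along the inclusion moves every measure
  into one fixed space, and a distortion \<open>e\<close> of the ground metrics becomes an additive
  error \<open>e\<close> between Wasserstein distances. From there on the argument concerns abstract
  metric spaces. Randomness is confined to finitely many almost sure events: convergence of the
  \<open>m\<close> empirical measures and Gromov-Hausdorff convergence. For a fixed sample point all
  else is deterministic, so one null set serves every \<epsilon>. Sets of
  \<open>k\<close>-barycenters may be non-unique, so no limit set can be named beforehand; the
  contradiction takes arbitrary bad sets at arbitrarily large \<open>n\<close>, which makes the
  threshold uniform over all \<open>S\<^sub>n\<close>.\<close>

definition ternary :: "(nat \<Rightarrow> bool) \<Rightarrow> real" where
  "ternary b = (\<Sum>k. 2 * of_bool (b k) / 3 ^ Suc k)"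

lemma summable_ternary: "summable (\<lambda>k. 2 * of_bool (b k) / 3 ^ Suc k :: real)"
proof (rule summable_comparison_test')
  show "summable (\<lambda>k. 2 / 3 * (1 / 3) ^ k :: real)"
    by (intro summable_mult summable_geometric) auto
  show "norm (2 * of_bool (b n) / 3 ^ Suc n :: real) \<le> 2 / 3 * (1 / 3) ^ n" for n
    by (auto simp: power_divide of_bool_def)
qed

lemma sums_ternary_tail: "(\<lambda>j. 2 / 3 ^ Suc (j + k) :: real) sums (1 / 3 ^ k)"
proof -
  have "(\<lambda>j. (2 / 3 ^ Suc k) * (1 / 3) ^ j :: real) sums ((2 / 3 ^ Suc k) * (1 / (1 - 1 / 3)))"
    by (intro sums_mult geometric_sums) auto
  then show ?thesis
    by (simp add: power_add power_divide mult_ac)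
qed

lemma ternary_bounds: "0 \<le> ternary b" "ternary b \<le> 1"
proof -
  show "0 \<le> ternary b"
    unfolding ternary_def by (intro suminf_nonneg summable_ternary) auto
  have "ternary b \<le> (\<Sum>j. 2 / 3 ^ Suc j)"
    unfolding ternary_def using sums_ternary_tail[of 0]
    by (intro suminf_le summable_ternary) (auto simp: sums_iff of_bool_def)
  also have "\<dots> = 1"
    using sums_ternary_tail[of 0] by (simp add: sums_iff)
  finally show "ternary b \<le> 1" .
qed

text \<open>Digit 2 against digit 0 at place \<open>k\<close> gains \<open>2 / 3 ^ Suc k\<close>,
  while all later digits together lose at most \<open>1 / 3 ^ Suc k\<close>. This gap is the reason
  for base three with digits 0 and 2; in binary the tail could cancel the gain.\<close>

lemma ternary_first_difference:
  assumes "b k" "\<not> c k" "\<And>j. j < k \<Longrightarrow> b j = c j"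
  shows "1 / 3 ^ Suc k \<le> ternary b - ternary c"
proof -
  let ?t = "\<lambda>j. 2 * of_bool (b j) / 3 ^ Suc j - 2 * of_bool (c j) / 3 ^ Suc j :: real"
  have sm: "summable ?t"
    by (intro summable_diff summable_ternary)
  have tail: "- (1 / 3 ^ Suc k) \<le> (\<Sum>j. ?t (j + Suc k))"
  proof -
    have "(\<Sum>j. - (2 / 3 ^ Suc (j + Suc k))) \<le> (\<Sum>j. ?t (j + Suc k))"
      using sums_ternary_tail[of "Suc k"]
      by (intro suminf_le summable_minus iffD2[OF summable_iff_shift sm])
        (auto simp: sums_iff of_bool_def)
    moreover have "(\<Sum>j. - (2 / 3 ^ Suc (j + Suc k)) :: real) = - (1 / 3 ^ Suc k)"
      using sums_minus[OF sums_ternary_tail[of "Suc k"]] by (simp add: sums_iff)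
    ultimately show ?thesis by simp
  qed
  have "ternary b - ternary c = (\<Sum>j. ?t j)"
    unfolding ternary_def by (intro suminf_diff summable_ternary)
  also have "\<dots> = (\<Sum>j. ?t (j + Suc k)) + (\<Sum>j<Suc k. ?t j)"
    by (rule suminf_split_initial_segment[OF sm])
  also have "(\<Sum>j<Suc k. ?t j) = 2 / 3 ^ Suc k"
    using assms by simp
  finally show ?thesis
    using tail by simp
qed

text \<open>The first place of disagreement, if it lay before \<open>N\<close>, would already
  separate the codes by \<open>1 / 3 ^ N\<close>. Hence each digit depends on the code in a
  uniformly continuous way.\<close>

lemma ternary_close_imp_agree:
  assumes "\<bar>ternary b - ternary c\<bar> < 1 / 3 ^ N" "k < N"
  shows "b k = c k"
proof (rule ccontr)
  assume "b k \<noteq> c k"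
  then obtain k' where k': "b k' \<noteq> c k'" "\<And>j. j < k' \<Longrightarrow> b j = c j" "k' \<le> k"
    using exists_least_iff[of "\<lambda>k. b k \<noteq> c k"] by (metis not_le)
  have "1 / 3 ^ Suc k' \<le> \<bar>ternary b - ternary c\<bar>"
  proof (cases "b k'")
    case True
    then show ?thesis using ternary_first_difference[of b k' c] k' by fastforce
  next
    case False
    then show ?thesis using ternary_first_difference[of c k' b] k' by fastforce
  qed
  moreover have "(1 / 3 ^ N :: real) \<le> 1 / 3 ^ Suc k'"
    using k' assms(2) by (intro divide_left_mono power_increasing) auto
  ultimately show False using assms(1) by linarith
qed

text \<open>The code of a point records membership in countably many balls, so the Cantor-like set of
  codes is mapped back continuously although the coding itself is only Borel measurable.\<close>

lemma compact_coding:
  assumes "compact (UNIV :: 'a::metric_space set)"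
  obtains s :: "'a::metric_space \<Rightarrow> real" where "s \<in> borel_measurable borel" "\<And>x. 0 \<le> s x" "\<And>x. s x \<le> 1"
    "\<And>e. 0 < e \<Longrightarrow> \<exists>\<delta>>0. \<forall>x y. \<bar>s x - s y\<bar> < \<delta> \<longrightarrow> dist x y < e"
proof -
  have "\<exists>F. finite F \<and> (\<Union>x\<in>F. ball x (1 / real (Suc j))) = (UNIV :: 'a set)" for j
  proof -
    have "\<exists>F\<subseteq>UNIV. finite F \<and> (UNIV :: 'a set) \<subseteq> (\<Union>x\<in>F. ball x (1 / real (Suc j)))"
      using assms[unfolded compact_eq_totally_bounded, THEN conjunct2, rule_format,
        of "1 / real (Suc j)"] by simp
    then show ?thesis by auto
  qed
  then obtain F :: "nat \<Rightarrow> 'a set" where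
    F: "\<And>j. finite (F j)" "\<And>j. (\<Union>x\<in>F j. ball x (1 / real (Suc j))) = UNIV"
    by metis
  \<comment> \<open>Every centre is tagged with its scale, so a single enumeration \<open>q\<close>
    lists the balls of all scales and digit \<open>k\<close> of a code records membership in the
    ball \<open>q k\<close>.\<close>
  define D where "D = (SIGMA j:UNIV. F j)"
  have D: "countable D"
    unfolding D_def by (intro countable_SIGMA countable_finite[OF F(1)]) auto
  define q where "q = from_nat_into D"
  define b where "b x k \<longleftrightarrow> dist (snd (q k)) x < 1 / real (Suc (fst (q k)))" for x k
  show thesis
  proof (rule that)
    have "(\<lambda>x. of_bool (b x k) :: real) \<in> borel_measurable borel" for k
    proof -
      have "{x. b x k} = ball (snd (q k)) (1 / real (Suc (fst (q k))))"
        by (auto simp: b_def)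
      then have "{x. b x k} \<in> sets borel" by simp
      then have "(indicator {x. b x k} :: _ \<Rightarrow> real) \<in> borel_measurable borel"
        by simp
      then show ?thesis by (simp add: indicator_def[abs_def])
    qed
    then show "(\<lambda>x. ternary (b x)) \<in> borel_measurable borel"
      unfolding ternary_def by measurable
    show "0 \<le> ternary (b x)" "ternary (b x) \<le> 1" for x
      by (rule ternary_bounds)+
    fix e :: real assume "0 < e"
    then obtain j where j: "2 / real (Suc j) < e"
      using reals_Archimedean[of "e / 2"] by (auto simp: field_simps)
    have "\<exists>k. q k = (j, a)" if "a \<in> F j" for a
      using from_nat_into_surj[OF D, of "(j, a)"] that by (auto simp: q_def D_def)
    then obtain K where K: "\<And>a. a \<in> F j \<Longrightarrow> q (K a) = (j, a)"
      by metis
    \<comment> \<open>\<open>N\<close> exceeds the positions of all balls of scale \<open>j\<close>,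
      so codes closer than \<open>1 / 3 ^ N\<close> agree on each of them; one of these balls
      contains \<open>x\<close>, hence also \<open>y\<close>. The inserted 0 makes
      \<open>Max\<close> meaningful without discussing whether \<open>F j\<close> is empty.\<close>
    define N where "N = Suc (Max (insert 0 (K ` F j)))"
    have KN: "K a < N" if "a \<in> F j" for a
      unfolding N_def less_Suc_eq_le using F(1) that by (intro Max_ge) auto
    have "dist x y < e" if less: "\<bar>ternary (b x) - ternary (b y)\<bar> < 1 / 3 ^ N" for x y
    proof -
      obtain a where a: "a \<in> F j" "dist a x < 1 / real (Suc j)"
        using F(2)[of j] by (auto simp: set_eq_iff)
      then have "b x (K a)" by (simp add: b_def K)
      then have "b y (K a)" using ternary_close_imp_agree[OF less KN[OF a(1)]] by simp
      then have "dist a y < 1 / real (Suc j)" by (simp add: b_def K a)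
      then have "dist x y < 1 / real (Suc j) + 1 / real (Suc j)"
        using a(2) by (meson add_strict_mono dist_commute_lessI dist_triangle_less_add)
      then show ?thesis using j by simp
    qed
    then show "\<exists>\<delta>>0. \<forall>x y. \<bar>ternary (b x) - ternary (b y)\<bar> < \<delta> \<longrightarrow> dist x y < e"
      by (intro exI[of _ "1 / 3 ^ N"]) auto
  qed
qed

text \<open>The assumption \<open>unif\<close> says that the inverse of \<open>s\<close> is
  uniformly continuous on the codes. Compactness provides a limit of preimages at each point of the
  closure, and uniform continuity makes these limits fit together continuously.\<close>

lemma uniform_left_inverse_extension:
  fixes s :: "'a::metric_space \<Rightarrow> real"
  assumes "compact (UNIV :: 'a set)"
    and unif: "\<And>e. 0 < e \<Longrightarrow> \<exists>\<delta>>0. \<forall>x y. \<bar>s x - s y\<bar> < \<delta> \<longrightarrow> dist x y < e"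
  obtains g where "continuous_on (closure (range s)) g" "\<And>x. g (s x) = x"
proof -
  have "\<exists>z x. (\<lambda>n. s (x n)) \<longlonglongrightarrow> t \<and> x \<longlonglongrightarrow> z" if t: "t \<in> closure (range s)" for t
  proof -
    obtain u where u: "\<And>n. u n \<in> range s" "u \<longlonglongrightarrow> t"
      using t unfolding closure_sequential by blast
    have "\<forall>n. \<exists>y. u n = s y"
      using u(1) by blast
    then obtain x where x: "\<And>n. u n = s (x n)"
      by metis
    have "\<exists>z\<in>UNIV. \<exists>r :: nat \<Rightarrow> nat. strict_mono r \<and> (x \<circ> r) \<longlonglongrightarrow> z"
      using compact_imp_seq_compact[OF assms(1)] unfolding seq_compact_def by auto
    then obtain z r where r: "strict_mono (r :: nat \<Rightarrow> nat)" "(x \<circ> r) \<longlonglongrightarrow> z"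
      by blast
    have "(\<lambda>n. s ((x \<circ> r) n)) \<longlonglongrightarrow> t"
      using LIMSEQ_subseq_LIMSEQ[OF u(2) r(1)] x by (simp add: comp_def)
    with r show ?thesis by blast
  qed
  then obtain g x where
    g: "\<And>t. t \<in> closure (range s) \<Longrightarrow> (\<lambda>n. s (x t n)) \<longlonglongrightarrow> t"
       "\<And>t. t \<in> closure (range s) \<Longrightarrow> x t \<longlonglongrightarrow> g t"
    by metis
  show thesis
  proof (rule that)
    show "continuous_on (closure (range s)) g"
      unfolding continuous_on_iff
    proof (intro ballI allI impI)
      fix t and e :: real assume t: "t \<in> closure (range s)" and "0 < e"
      then obtain \<delta> where \<delta>: "\<delta> > 0" "\<And>x y. \<bar>s x - s y\<bar> < \<delta> \<Longrightarrow> dist x y < e / 2"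
        using unif[of "e / 2"] by auto
      have "dist (g t') (g t) < e" if t': "t' \<in> closure (range s)" "dist t' t < \<delta>" for t'
      proof -
        have "(\<lambda>n. dist (s (x t' n)) (s (x t n))) \<longlonglongrightarrow> dist t' t"
          by (intro tendsto_dist g t t')
        then have "\<forall>\<^sub>F n in sequentially. dist (s (x t' n)) (s (x t n)) < \<delta>"
          using t'(2) order_tendstoD by blast
        then have "\<forall>\<^sub>F n in sequentially. dist (x t' n) (x t n) \<le> e / 2"
          by eventually_elim (use \<delta>(2) in \<open>auto simp: dist_real_def less_imp_le\<close>)
        then have "dist (g t') (g t) \<le> e / 2"
          by (intro tendsto_upperbound[OF tendsto_dist[OF g(2)[OF t'(1)] g(2)[OF t]]]) auto
        then show ?thesis using \<open>0 < e\<close> by simp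
      qed
      then show "\<exists>d>0. \<forall>x'\<in>closure (range s). dist x' t < d \<longrightarrow> dist (g x') (g t) < e"
        using \<delta>(1) by blast
    qed
    fix y
    have sy: "s y \<in> closure (range s)"
      by (rule subsetD[OF closure_subset]) simp
    \<comment> \<open>The sequence chosen for the code \<open>s y\<close> may avoid \<open>y\<close>
      altogether, but its codes approach \<open>s y\<close>, which forces its points towards
      \<open>y\<close>.\<close>
    have "x (s y) \<longlonglongrightarrow> y"
    proof (rule tendstoI)
      fix e :: real assume "0 < e"
      then obtain \<delta> where \<delta>: "\<delta> > 0" "\<And>x y. \<bar>s x - s y\<bar> < \<delta> \<Longrightarrow> dist x y < e"
        using unif by blast
      have "\<forall>\<^sub>F n in sequentially. dist (s (x (s y) n)) (s y) < \<delta>"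
        using tendstoD[OF g(1)[OF sy] \<delta>(1)] .
      then show "\<forall>\<^sub>F n in sequentially. dist (x (s y) n) y < e"
        by eventually_elim (use \<delta>(2) in \<open>auto simp: dist_real_def\<close>)
    qed
    then show "g (s y) = y"
      using LIMSEQ_unique[OF g(2)[OF sy]] by simp
  qed
qed

subsection \<open>Gluing of couplings\<close>

text \<open>Over each point of the finite set \<open>F\<close> the two fibres are coupled independently; this
  replaces disintegration in the proof of the triangle inequality.\<close>

lemma finite_fibre_coupling:
  fixes P :: "'b measure" and Q :: "'c measure" and S :: "'b \<Rightarrow> 'd" and T :: "'c \<Rightarrow> 'd"
  assumes "prob_space P" "prob_space Q" and F: "finite F"
    and S[measurable]: "S \<in> P \<rightarrow>\<^sub>M count_space F" and T[measurable]: "T \<in> Q \<rightarrow>\<^sub>M count_space F"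
    and eq: "distr P (count_space F) S = distr Q (count_space F) T"
  obtains \<Gamma> where "sets \<Gamma> = sets (P \<Otimes>\<^sub>M Q)" "distr \<Gamma> P fst = P" "distr \<Gamma> Q snd = Q"
    "AE z in \<Gamma>. S (fst z) = T (snd z)"
proof -
  interpret P: prob_space P by fact
  interpret Q: prob_space Q by fact
  interpret PQ: pair_sigma_finite P Q ..
  define A where "A a = S -` {a} \<inter> space P" for a
  define A' where "A' a = T -` {a} \<inter> space Q" for a
  have A[measurable]: "A a \<in> sets P" and A'[measurable]: "A' a \<in> sets Q" if "a \<in> F" for a
    unfolding A_def A'_def using that by (auto intro!: measurable_sets[OF S] measurable_sets[OF T])
  have AA': "emeasure P (A a) = emeasure Q (A' a)" if "a \<in> F" for a
    using arg_cong[OF eq, of "\<lambda>M. emeasure M {a}"] that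
    by (simp add: emeasure_distr A_def A'_def)
  \<comment> \<open>The weight normalises the product of the two measures on the cell over
    \<open>a\<close>. On a null cell real division by zero gives weight 0, so that cell is left
    out.\<close>
  define c where "c a = ennreal (1 / measure P (A a))" for a
  have c: "c a * emeasure P (A a) = 1" if "emeasure P (A a) \<noteq> 0" for a
    using that by (simp add: c_def P.emeasure_eq_measure measure_nonneg flip: ennreal_mult)
  define w where "w z = (\<Sum>a\<in>F. c a * (indicator (A a) (fst z) * indicator (A' a) (snd z)))" for z
  have w[measurable]: "w \<in> borel_measurable (P \<Otimes>\<^sub>M Q)"
    unfolding w_def by measurable
  define \<Gamma> where "\<Gamma> = density (P \<Otimes>\<^sub>M Q) w"
  \<comment> \<open>Rectangles suffice: both marginals are read off by taking one side to be the
    whole space.\<close>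
  have box: "emeasure \<Gamma> (E \<times> E') =
      (\<Sum>a\<in>F. c a * (emeasure P (A a \<inter> E) * emeasure Q (A' a \<inter> E')))"
    if [measurable]: "E \<in> sets P" "E' \<in> sets Q" for E E'
  proof -
    have "emeasure \<Gamma> (E \<times> E') = (\<integral>\<^sup>+z. w z * indicator (E \<times> E') z \<partial>(P \<Otimes>\<^sub>M Q))"
      unfolding \<Gamma>_def by (intro emeasure_density) auto
    also have "\<dots> = (\<integral>\<^sup>+z. (\<Sum>a\<in>F. c a * indicator ((A a \<inter> E) \<times> (A' a \<inter> E')) z) \<partial>(P \<Otimes>\<^sub>M Q))"
      unfolding w_def sum_distrib_right
      by (intro nn_integral_cong sum.cong refl) (auto simp: indicator_def)
    also have "\<dots> = (\<Sum>a\<in>F. c a * emeasure (P \<Otimes>\<^sub>M Q) ((A a \<inter> E) \<times> (A' a \<inter> E')))"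
      by (subst nn_integral_sum) (auto intro!: sum.cong nn_integral_cmult_indicator)
    finally show ?thesis
      by (simp add: Q.emeasure_pair_measure_Times)
  qed
  have partP: "emeasure P E = (\<Sum>a\<in>F. emeasure P (A a \<inter> E))" if [measurable]: "E \<in> sets P" for E
  proof -
    have "E = (\<Union>a\<in>F. A a \<inter> E)"
      using sets.sets_into_space[OF that] measurable_space[OF S] by (auto simp: A_def)
    then have "emeasure P E = emeasure P (\<Union>a\<in>F. A a \<inter> E)"
      by simp
    also have "\<dots> = (\<Sum>a\<in>F. emeasure P (A a \<inter> E))"
      by (rule sum_emeasure[symmetric]) (auto simp: F disjoint_family_on_def A_def)
    finally show ?thesis .
  qed
  have partQ: "emeasure Q E = (\<Sum>a\<in>F. emeasure Q (A' a \<inter> E))" if [measurable]: "E \<in> sets Q" for E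
  proof -
    have "E = (\<Union>a\<in>F. A' a \<inter> E)"
      using sets.sets_into_space[OF that] measurable_space[OF T] by (auto simp: A'_def)
    then have "emeasure Q E = emeasure Q (\<Union>a\<in>F. A' a \<inter> E)"
      by simp
    also have "\<dots> = (\<Sum>a\<in>F. emeasure Q (A' a \<inter> E))"
      by (rule sum_emeasure[symmetric]) (auto simp: F disjoint_family_on_def A'_def)
    finally show ?thesis .
  qed
  have sets_\<Gamma>: "sets \<Gamma> = sets (P \<Otimes>\<^sub>M Q)" and space_\<Gamma>: "space \<Gamma> = space P \<times> space Q"
    by (auto simp: \<Gamma>_def space_pair_measure)
  show thesis
  proof (rule that)
    show "sets \<Gamma> = sets (P \<Otimes>\<^sub>M Q)" by fact
    have [measurable]: "fst \<in> \<Gamma> \<rightarrow>\<^sub>M P" "snd \<in> \<Gamma> \<rightarrow>\<^sub>M Q"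
      by (simp_all add: measurable_cong_sets[OF sets_\<Gamma> refl])
    show "distr \<Gamma> P fst = P"
    proof (rule measure_eqI)
      fix E assume "E \<in> sets (distr \<Gamma> P fst)"
      then have E[measurable]: "E \<in> sets P" by simp
      have "emeasure (distr \<Gamma> P fst) E = emeasure \<Gamma> (E \<times> space Q)"
        using sets.sets_into_space[OF E]
        by (subst emeasure_distr) (auto simp: space_\<Gamma> intro!: arg_cong[of _ _ "emeasure \<Gamma>"])
      also have "\<dots> = (\<Sum>a\<in>F. emeasure P (A a \<inter> E))"
      proof (subst box, measurable, intro sum.cong refl)
        fix a assume a: "a \<in> F"
        have le: "emeasure P (A a \<inter> E) \<le> emeasure P (A a)"
          using a by (intro emeasure_mono) auto
        have "A' a \<inter> space Q = A' a" by (auto simp: A'_def)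
        then show "c a * (emeasure P (A a \<inter> E) * emeasure Q (A' a \<inter> space Q)) = emeasure P (A a \<inter> E)"
          using le c[of a] AA'[OF a]
          by (cases "emeasure P (A a) = 0") (auto simp: mult_ac simp flip: mult.assoc)
      qed
      also have "\<dots> = emeasure P E" using partP[OF E] by simp
      finally show "emeasure (distr \<Gamma> P fst) E = emeasure P E" .
    qed simp
    show "distr \<Gamma> Q snd = Q"
    proof (rule measure_eqI)
      fix E assume "E \<in> sets (distr \<Gamma> Q snd)"
      then have E[measurable]: "E \<in> sets Q" by simp
      have "emeasure (distr \<Gamma> Q snd) E = emeasure \<Gamma> (space P \<times> E)"
        using sets.sets_into_space[OF E]
        by (subst emeasure_distr) (auto simp: space_\<Gamma> intro!: arg_cong[of _ _ "emeasure \<Gamma>"])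
      also have "\<dots> = (\<Sum>a\<in>F. emeasure Q (A' a \<inter> E))"
      proof (subst box, measurable, intro sum.cong refl)
        fix a assume a: "a \<in> F"
        have le: "emeasure Q (A' a \<inter> E) \<le> emeasure Q (A' a)"
          using a by (intro emeasure_mono) auto
        have "A a \<inter> space P = A a" by (auto simp: A_def)
        then show "c a * (emeasure P (A a \<inter> space P) * emeasure Q (A' a \<inter> E)) = emeasure Q (A' a \<inter> E)"
          using le c[of a] AA'[OF a]
          by (cases "emeasure P (A a) = 0") (auto simp flip: mult.assoc)
      qed
      also have "\<dots> = emeasure Q E" using partQ[OF E] by simp
      finally show "emeasure (distr \<Gamma> Q snd) E = emeasure Q E" .
    qed simp
    have "S (fst z) = T (snd z)" if "0 < w z" for z
    proof -
      have "w z \<noteq> 0" using that by simp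
      then obtain a where "c a * (indicator (A a) (fst z) * indicator (A' a) (snd z)) \<noteq> (0::ennreal)"
        unfolding w_def using F by (auto simp: sum_eq_0_iff)
      then have "fst z \<in> A a" "snd z \<in> A' a"
        by (auto simp: indicator_def split: if_splits)
      then show ?thesis by (auto simp: A_def A'_def)
    qed
    then show "AE z in \<Gamma>. S (fst z) = T (snd z)"
      unfolding \<Gamma>_def by (subst AE_density) auto
  qed
qed

text \<open>Minkowski's inequality in \<open>L\<^sup>2\<close>, in a form that avoids square roots
  of integrals. Pointwise, a square of a sum is at most a weighted sum of squares, and the weights
  \<open>1 + B / A\<close> and \<open>1 + A / B\<close> are chosen so that the bounds add up to
  exactly \<open>(A + B)\<^sup>2\<close>. Strict positivity is arranged in the applications by
  bounds strictly above the distances.\<close>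

lemma nn_integral_square_add:
  fixes f g h :: "'b \<Rightarrow> real"
  assumes [measurable]: "f \<in> borel_measurable M" "g \<in> borel_measurable M"
    and h: "AE z in M. 0 \<le> h z \<and> h z \<le> f z + g z"
    and f: "(\<integral>\<^sup>+z. ennreal ((f z)\<^sup>2) \<partial>M) \<le> ennreal (A\<^sup>2)"
    and g: "(\<integral>\<^sup>+z. ennreal ((g z)\<^sup>2) \<partial>M) \<le> ennreal (B\<^sup>2)"
    and "0 < A" "0 < B"
  shows "(\<integral>\<^sup>+z. ennreal ((h z)\<^sup>2) \<partial>M) \<le> ennreal ((A + B)\<^sup>2)"
proof -
  have "(h z)\<^sup>2 \<le> (1 + B / A) * (f z)\<^sup>2 + (1 + A / B) * (g z)\<^sup>2"
    if "0 \<le> h z" "h z \<le> f z + g z" for z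
  proof -
    have "(h z)\<^sup>2 \<le> (f z + g z)\<^sup>2"
      using that by (intro power_mono) auto
    \<comment> \<open>The defect in the weighted inequality is itself a square, whence its
      sign.\<close>
    also have "\<dots> + (B * f z - A * g z)\<^sup>2 / (A * B) = (1 + B / A) * (f z)\<^sup>2 + (1 + A / B) * (g z)\<^sup>2"
      using assms(6,7) by (simp add: field_simps power2_eq_square)
    moreover have "(B * f z - A * g z)\<^sup>2 / (A * B) \<ge> 0"
      using assms(6,7) by simp
    ultimately show ?thesis by linarith
  qed
  then have "(\<integral>\<^sup>+z. ennreal ((h z)\<^sup>2) \<partial>M) \<le>
      (\<integral>\<^sup>+z. ennreal (1 + B / A) * ennreal ((f z)\<^sup>2) + ennreal (1 + A / B) * ennreal ((g z)\<^sup>2) \<partial>M)"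
    using h assms(6,7)
    by (intro nn_integral_mono_AE, elim eventually_mono)
      (auto simp flip: ennreal_mult ennreal_plus intro!: ennreal_leI)
  also have "\<dots> = ennreal (1 + B / A) * (\<integral>\<^sup>+z. ennreal ((f z)\<^sup>2) \<partial>M)
      + ennreal (1 + A / B) * (\<integral>\<^sup>+z. ennreal ((g z)\<^sup>2) \<partial>M)"
    by (simp add: nn_integral_add nn_integral_cmult)
  also have "\<dots> \<le> ennreal (1 + B / A) * ennreal (A\<^sup>2) + ennreal (1 + A / B) * ennreal (B\<^sup>2)"
    by (intro add_mono mult_left_mono f g) auto
  also have "\<dots> = ennreal ((1 + B / A) * A\<^sup>2 + (1 + A / B) * B\<^sup>2)"
    using assms(6,7) by (simp flip: ennreal_mult ennreal_plus)
  also have "(1 + B / A) * A\<^sup>2 + (1 + A / B) * B\<^sup>2 = (A + B)\<^sup>2"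
    using assms(6,7) by (simp add: field_simps power2_eq_square)
  finally show ?thesis .
qed

section \<open>Borel sets of a metric and first bounds for the Wasserstein distance\<close>

lemma space_metric_borel:
  assumes "Metric_space Y \<rho>" shows "space (metric_borel Y \<rho>) = Y"
  using Metric_space.topspace_mtopology[OF assms] openin_subset
  unfolding metric_borel_def by (intro space_measure_of) fastforce

lemma sets_metric_borel:
  assumes "Metric_space Y \<rho>"
  shows "sets (metric_borel Y \<rho>) = sigma_sets Y {U. openin (Metric_space.mtopology Y \<rho>) U}"
  using Metric_space.topspace_mtopology[OF assms] openin_subset
  unfolding metric_borel_def by (intro sets_measure_of) fastforce

lemma wasserstein2_nonneg [simp]: "0 \<le> wasserstein2 \<rho> \<mu> \<nu>"
  by (simp add: wasserstein2_def)

lemma wasserstein2_le: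
  assumes "\<pi> \<in> couplings \<mu> \<nu>" "0 \<le> A"
    and "(\<integral>\<^sup>+ z. ennreal ((\<rho> (fst z) (snd z))\<^sup>2) \<partial>\<pi>) \<le> ennreal (A\<^sup>2)"
  shows "wasserstein2 \<rho> \<mu> \<nu> \<le> A"
proof -
  have "(INF \<pi> \<in> couplings \<mu> \<nu>. \<integral>\<^sup>+ z. ennreal ((\<rho> (fst z) (snd z))\<^sup>2) \<partial>\<pi>) \<le> ennreal (A\<^sup>2)"
    using assms by (intro INF_lower2)
  then have "enn2real (INF \<pi> \<in> couplings \<mu> \<nu>. \<integral>\<^sup>+ z. ennreal ((\<rho> (fst z) (snd z))\<^sup>2) \<partial>\<pi>) \<le> A\<^sup>2"
    by (intro enn2real_leI) auto
  then show ?thesis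
    using real_le_lsqrt[OF \<open>0 \<le> A\<close>] by (auto simp: wasserstein2_def)
qed

lemma borel_measurable_metric_borel_dist:
  assumes "Metric_space Y \<rho>" "x \<in> Y"
  shows "(\<lambda>y. \<rho> y x) \<in> borel_measurable (metric_borel Y \<rho>)"
proof -
  interpret Metric_space Y \<rho> by fact
  have "{y \<in> Y. \<rho> y x < a} = mball x a" for a
    using assms(2) by (auto simp: commute)
  moreover have "mball x a \<in> sets (metric_borel Y \<rho>)" for a
    unfolding sets_metric_borel[OF assms(1)] by (auto intro!: sigma_sets.Basic)
  ultimately show ?thesis
    unfolding borel_measurable_iff_less using assms(1) by (simp add: space_metric_borel)
qed

text \<open>Taking the least index among the net points that are close enough makes the choice
  measurable; the fibres of the resulting map are the small cells over which couplings are
  glued.\<close>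

lemma measurable_near_point_map:
  assumes "Metric_space Y \<rho>" "finite F" "F \<subseteq> Y" "\<And>x. x \<in> Y \<Longrightarrow> \<exists>a\<in>F. \<rho> x a < e"
  obtains T where "T \<in> metric_borel Y \<rho> \<rightarrow>\<^sub>M count_space F" "\<And>x. x \<in> Y \<Longrightarrow> \<rho> x (T x) < e"
proof -
  interpret Metric_space Y \<rho> by fact
  obtain a where a: "F = a ` {i. i < card F}"
    using \<open>finite F\<close> by (metis finite_imp_nat_seg_image_inj_on card_image card_Collect_less_nat)
  define I where "I x = (LEAST i. i < card F \<and> \<rho> x (a i) < e)" for x
  have I: "I x < card F \<and> \<rho> x (a (I x)) < e" if "x \<in> Y" for x
  proof -
    have "\<exists>i. i < card F \<and> \<rho> x (a i) < e"
      using assms(4)[OF that] by (subst (asm) a) auto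
    then show ?thesis unfolding I_def by (rule LeastI_ex)
  qed
  have "(\<lambda>x. i < card F \<and> \<rho> x (a i) < e) \<in> metric_borel Y \<rho> \<rightarrow>\<^sub>M count_space UNIV" for i
  proof (cases "i < card F")
    case True
    then have "a i \<in> Y" using a assms(3) by auto
    then have [measurable]: "(\<lambda>x. \<rho> x (a i)) \<in> borel_measurable (metric_borel Y \<rho>)"
      by (rule borel_measurable_metric_borel_dist[OF assms(1)])
    show ?thesis by measurable
  qed auto
  then have "I \<in> metric_borel Y \<rho> \<rightarrow>\<^sub>M count_space UNIV"
    unfolding I_def by (rule measurable_Least)
  then have "(\<lambda>x. a (I x)) \<in> metric_borel Y \<rho> \<rightarrow>\<^sub>M count_space UNIV"
    by (rule measurable_compose) simp
  moreover have "(\<lambda>x. a (I x)) \<in> space (metric_borel Y \<rho>) \<rightarrow> F"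
    using I by (subst a) (auto simp: space_metric_borel[OF assms(1)])
  ultimately have "(\<lambda>x. a (I x)) \<in> metric_borel Y \<rho> \<rightarrow>\<^sub>M count_space F"
    by (simp add: measurable_count_space_eq_countable measurable_def countable_finite[OF \<open>finite F\<close>])
  then show thesis using that I by blast
qed

subsection \<open>The Wasserstein distance is a metric\<close>

text \<open>For arbitrary \<open>f\<close> the integral is a supremum over simple functions below
  \<open>f\<close>. Those on the image space pull back to \<open>M\<close>, but \<open>M\<close> may
  carry more simple functions, so the inequality can be strict. For the symmetry of the Wasserstein
  distance it is applied in both directions.\<close>

lemma nn_integral_distr_le:
  assumes [measurable]: "T \<in> M \<rightarrow>\<^sub>M N"
  shows "(\<integral>\<^sup>+ y. f y \<partial>distr M N T) \<le> (\<integral>\<^sup>+ x. f (T x) \<partial>M)"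
  unfolding nn_integral_def[of "distr M N T"]
proof (intro SUP_least)
  fix g assume "g \<in> {g. simple_function (distr M N T) g \<and> g \<le> f}"
  then have g: "simple_function (distr M N T) g" "g \<le> f" by auto
  have [measurable]: "g \<in> borel_measurable N"
    using borel_measurable_simple_function[OF g(1)] by simp
  have "integral\<^sup>S (distr M N T) g = (\<integral>\<^sup>+ y. g y \<partial>distr M N T)"
    by (rule nn_integral_eq_simple_integral[OF g(1), symmetric])
  also have "\<dots> = (\<integral>\<^sup>+ x. g (T x) \<partial>M)"
    by (rule nn_integral_distr) auto
  also have "\<dots> \<le> (\<integral>\<^sup>+ x. f (T x) \<partial>M)"
    using g(2) by (intro nn_integral_mono) (auto simp: le_fun_def)
  finally show "integral\<^sup>S (distr M N T) g \<le> (\<integral>\<^sup>+ x. f (T x) \<partial>M)" .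
qed

text \<open>The measures are arbitrary here: the symmetry axiom of \<^const>\<open>Metric_space\<close> is not relative
  to the carrier.\<close>

lemma wasserstein2_commute:
  assumes sym: "\<And>x y. \<rho> x y = \<rho> y x"
  shows "wasserstein2 \<rho> \<mu> \<nu> = wasserstein2 \<rho> \<nu> \<mu>"
proof -
  let ?c = "\<lambda>\<pi>. \<integral>\<^sup>+ z. ennreal ((\<rho> (fst z) (snd z))\<^sup>2) \<partial>\<pi>"
  have "(INF \<pi> \<in> couplings \<nu> \<mu>. ?c \<pi>) \<le> (INF \<pi> \<in> couplings \<mu> \<nu>. ?c \<pi>)" for \<mu> \<nu>
  proof (rule INF_greatest)
    fix \<pi> assume \<pi>: "\<pi> \<in> couplings \<mu> \<nu>"
    then have sets: "sets \<pi> = sets (\<mu> \<Otimes>\<^sub>M \<nu>)" by (simp add: couplings_def)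
    have m[measurable]: "fst \<in> \<pi> \<rightarrow>\<^sub>M \<mu>" "snd \<in> \<pi> \<rightarrow>\<^sub>M \<nu>"
      by (simp_all add: measurable_cong_sets[OF sets refl])
    let ?\<pi>' = "distr \<pi> (\<nu> \<Otimes>\<^sub>M \<mu>) (\<lambda>z. (snd z, fst z))"
    have "distr ?\<pi>' \<nu> fst = distr \<pi> \<nu> snd" "distr ?\<pi>' \<mu> snd = distr \<pi> \<mu> fst"
      by (simp_all add: distr_distr comp_def)
    then have "?\<pi>' \<in> couplings \<nu> \<mu>"
      using \<pi> by (simp add: couplings_def)
    moreover have "?c ?\<pi>' \<le> ?c \<pi>"
      using nn_integral_distr_le[of "\<lambda>z. (snd z, fst z)" \<pi> "\<nu> \<Otimes>\<^sub>M \<mu>" "\<lambda>z. ennreal ((\<rho> (fst z) (snd z))\<^sup>2)"]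
      by (simp add: sym)
    ultimately show "(INF \<pi> \<in> couplings \<nu> \<mu>. ?c \<pi>) \<le> ?c \<pi>"
      by (rule INF_lower2)
  qed
  then show ?thesis
    unfolding wasserstein2_def by (intro arg_cong[of _ _ "\<lambda>x. sqrt (enn2real x)"] order_antisym)
qed

text \<open>The common setting of the compact ambient space and of the finite sample spaces. Finite
  nets give small cells for gluing, joint measurability of the metric and a bound on the
  diameter.\<close>

locale totally_bounded_metric_space = Metric_space Y \<rho>
  for Y :: "'b set" and \<rho> :: "'b \<Rightarrow> 'b \<Rightarrow> real" +
  assumes totally_bounded: "mtotally_bounded Y"
begin

abbreviation "B \<equiv> metric_borel Y \<rho>"
abbreviation "\<P> \<equiv> prob_measures Y \<rho>"
abbreviation "W \<equiv> wasserstein2 \<rho>"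

lemma space_B [simp]: "space B = Y"
  by (rule space_metric_borel) (rule Metric_space_axioms)

lemma sets_B: "sets B = sigma_sets Y {U. openin mtopology U}"
  by (rule sets_metric_borel) (rule Metric_space_axioms)

lemma openin_sets_B: "openin mtopology U \<Longrightarrow> U \<in> sets B"
  by (auto simp: sets_B)

lemma closedin_sets_B: "closedin mtopology C \<Longrightarrow> C \<in> sets B"
  using openin_sets_B[of "Y - C"] sets.compl_sets[of "Y - C" B]
  by (auto simp: closedin_def double_diff)

lemma near_point_map:
  assumes e: "0 < e"
  obtains F T where "finite F" "F \<subseteq> Y" "T \<in> B \<rightarrow>\<^sub>M count_space F" "\<And>x. x \<in> Y \<Longrightarrow> \<rho> x (T x) < e"
proof -
  obtain F where F: "finite F" "F \<subseteq> Y" "Y \<subseteq> (\<Union>x\<in>F. mball x e)"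
    using totally_bounded assms unfolding mtotally_bounded_def by meson
  have "\<exists>a\<in>F. \<rho> x a < e" if x: "x \<in> Y" for x
  proof -
    obtain a where "a \<in> F" "x \<in> mball a e" using F(3) x by blast
    then show ?thesis by (auto simp: commute[of x])
  qed
  then show thesis
    using measurable_near_point_map[OF Metric_space_axioms F(1,2)] that F(1,2) by blast
qed

text \<open>Joint continuity by itself speaks about the Borel sets of the product space, not about
  the product sigma-algebra. Replacing both arguments by net points gives functions that factor
  through finite sets and converge to the metric with error \<open>2 / (n + 1)\<close>.\<close>

lemma borel_measurable_metric [measurable]:
  "(\<lambda>z. \<rho> (fst z) (snd z)) \<in> borel_measurable (B \<Otimes>\<^sub>M B)"
proof -
  have "\<exists>F T. finite F \<and> F \<subseteq> Y \<and> T \<in> B \<rightarrow>\<^sub>M count_space F \<and> (\<forall>x\<in>Y. \<rho> x (T x) < inverse (real (Suc n)))" for n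
    by (rule near_point_map[of "inverse (real (Suc n))"]) auto
  then obtain F T where F: "\<And>n. finite (F n)" "\<And>n. F n \<subseteq> Y"
    and T[measurable]: "\<And>n. T n \<in> B \<rightarrow>\<^sub>M count_space (F n)"
    and near: "\<And>n x. x \<in> Y \<Longrightarrow> \<rho> x (T n x) < inverse (real (Suc n))"
    by metis
  have TY: "T n x \<in> Y" if "x \<in> Y" for n x
    using measurable_space[OF T] F(2) that by auto
  show ?thesis
  proof (rule borel_measurable_LIMSEQ_real)
    fix z assume "z \<in> space (B \<Otimes>\<^sub>M B)"
    then have z: "fst z \<in> Y" "snd z \<in> Y" by (auto simp: space_pair_measure)
    show "(\<lambda>n. \<rho> (T n (fst z)) (T n (snd z))) \<longlonglongrightarrow> \<rho> (fst z) (snd z)"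
    proof (rule LIM_zero_cancel, rule Lim_null_comparison)
      show "(\<lambda>n. 2 * inverse (real (Suc n))) \<longlonglongrightarrow> 0"
        by (intro tendsto_mult_right_zero LIMSEQ_inverse_real_of_nat)
      have "\<bar>\<rho> (T n (fst z)) (T n (snd z)) - \<rho> (fst z) (snd z)\<bar> \<le> 2 * inverse (real (Suc n))" for n
        using near[OF z(1), of n] near[OF z(2), of n]
          triangle[of "fst z" "T n (fst z)" "snd z"] triangle[of "T n (fst z)" "T n (snd z)" "snd z"]
          triangle[of "T n (fst z)" "fst z" "T n (snd z)"] triangle[of "fst z" "snd z" "T n (snd z)"]
          z TY commute[of "T n (fst z)" "fst z"] commute[of "T n (snd z)" "snd z"]
        by auto
      then show "\<forall>\<^sub>F n in sequentially. norm (\<rho> (T n (fst z)) (T n (snd z)) - \<rho> (fst z) (snd z))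
          \<le> 2 * inverse (real (Suc n))"
        by simp
    qed
  next
    fix n
    have r: "(\<lambda>p. \<rho> (fst p) (snd p)) \<in> borel_measurable (count_space (F n) \<Otimes>\<^sub>M count_space (F n))"
      by (simp add: pair_measure_countable countable_finite F)
    have "(\<lambda>z. (T n (fst z), T n (snd z))) \<in> B \<Otimes>\<^sub>M B \<rightarrow>\<^sub>M count_space (F n) \<Otimes>\<^sub>M count_space (F n)"
      by (intro measurable_Pair measurable_compose[OF measurable_fst T] measurable_compose[OF measurable_snd T])
    from measurable_compose[OF this r]
    show "(\<lambda>z. \<rho> (T n (fst z)) (T n (snd z))) \<in> borel_measurable (B \<Otimes>\<^sub>M B)"
      by simp
  qed
qed

lemma metric_bounded: "\<exists>D>0. \<forall>x\<in>Y. \<forall>y\<in>Y. \<rho> x y \<le> D"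
  using mtotally_bounded_imp_mbounded[OF totally_bounded] by (simp add: mbounded_alt_pos Bex_def Ball_def)

lemma prob_measuresD:
  assumes "\<mu> \<in> \<P>"
  shows "prob_space \<mu>" "space \<mu> = Y" "sets \<mu> = sets B"
  using assms by (auto simp: prob_measures_def)

lemma couplingsD:
  assumes "\<mu> \<in> \<P>" "\<nu> \<in> \<P>" "\<pi> \<in> couplings \<mu> \<nu>"
  shows "sets \<pi> = sets (B \<Otimes>\<^sub>M B)" "space \<pi> = Y \<times> Y" "prob_space \<pi>"
    "distr \<pi> B fst = distr \<mu> B id" "distr \<pi> B snd = distr \<nu> B id"
    "distr \<pi> \<mu> fst = \<mu>" "distr \<pi> \<nu> snd = \<nu>"
    "fst \<in> \<pi> \<rightarrow>\<^sub>M B" "snd \<in> \<pi> \<rightarrow>\<^sub>M B"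
proof -
  note \<mu> = prob_measuresD[OF assms(1)] and \<nu> = prob_measuresD[OF assms(2)]
  show sets: "sets \<pi> = sets (B \<Otimes>\<^sub>M B)"
    using assms(3) \<mu> \<nu> by (auto simp: couplings_def cong: sets_pair_measure_cong)
  show "space \<pi> = Y \<times> Y"
    using sets_eq_imp_space_eq[OF sets] by (simp add: space_pair_measure)
  show d: "distr \<pi> \<mu> fst = \<mu>" "distr \<pi> \<nu> snd = \<nu>"
    using assms(3) by (auto simp: couplings_def)
  show "fst \<in> \<pi> \<rightarrow>\<^sub>M B" "snd \<in> \<pi> \<rightarrow>\<^sub>M B"
    by (simp_all add: measurable_cong_sets[OF sets refl])
  then have m: "fst \<in> \<pi> \<rightarrow>\<^sub>M \<mu>" "snd \<in> \<pi> \<rightarrow>\<^sub>M \<nu>"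
    by (simp_all add: measurable_cong_sets[OF refl \<mu>(3)] measurable_cong_sets[OF refl \<nu>(3)])
  show "prob_space \<pi>"
    using m(1) \<mu>(1) d(1) by (metis prob_space_distrD)
  have "distr \<mu> B id = distr (distr \<pi> \<mu> fst) B id" "distr \<nu> B id = distr (distr \<pi> \<nu> snd) B id"
    by (simp_all add: d)
  moreover have "distr (distr \<pi> \<mu> fst) B id = distr \<pi> B fst" "distr (distr \<pi> \<nu> snd) B id = distr \<pi> B snd"
    using m by (simp_all add: distr_distr measurable_cong_sets[OF \<mu>(3) refl] measurable_cong_sets[OF \<nu>(3) refl])
  ultimately show "distr \<pi> B fst = distr \<mu> B id" "distr \<pi> B snd = distr \<nu> B id"
    by simp_all
qed

lemma distr_in_couplings:
  assumes "prob_space \<Omega>" "f \<in> \<Omega> \<rightarrow>\<^sub>M B" "g \<in> \<Omega> \<rightarrow>\<^sub>M B"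
    and "\<mu> \<in> \<P>" "\<nu> \<in> \<P>" "distr \<Omega> B f = \<mu>" "distr \<Omega> B g = \<nu>"
  shows "distr \<Omega> (\<mu> \<Otimes>\<^sub>M \<nu>) (\<lambda>z. (f z, g z)) \<in> couplings \<mu> \<nu>"
proof -
  note \<mu> = prob_measuresD[OF assms(4)] and \<nu> = prob_measuresD[OF assms(5)]
  have [measurable]: "f \<in> \<Omega> \<rightarrow>\<^sub>M \<mu>" "g \<in> \<Omega> \<rightarrow>\<^sub>M \<nu>"
    using assms(2,3) by (simp_all add: measurable_cong_sets[OF refl \<mu>(3)] measurable_cong_sets[OF refl \<nu>(3)])
  have "distr \<Omega> \<mu> f = \<mu>" "distr \<Omega> \<nu> g = \<nu>"
    using assms(6,7) \<mu>(3) \<nu>(3) distr_cong[OF refl, of \<mu> B \<Omega> f f] distr_cong[OF refl, of \<nu> B \<Omega> g g]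
    by simp_all
  then show ?thesis
    by (simp add: couplings_def distr_distr comp_def)
qed

text \<open>The probabilistic form of the upper bound: two random points on one probability space
  with the prescribed laws. All later estimates from above construct such a pair.\<close>

lemma wasserstein2_le_distr:
  assumes "prob_space \<Omega>" and [measurable]: "f \<in> \<Omega> \<rightarrow>\<^sub>M B" "g \<in> \<Omega> \<rightarrow>\<^sub>M B"
    and \<mu>\<nu>: "\<mu> \<in> \<P>" "\<nu> \<in> \<P>" "distr \<Omega> B f = \<mu>" "distr \<Omega> B g = \<nu>"
    and "0 \<le> A" "(\<integral>\<^sup>+ z. ennreal ((\<rho> (f z) (g z))\<^sup>2) \<partial>\<Omega>) \<le> ennreal (A\<^sup>2)"
  shows "W \<mu> \<nu> \<le> A"
proof (rule wasserstein2_le[OF distr_in_couplings[OF assms(1-7)] \<open>0 \<le> A\<close>])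
  have "sets (\<mu> \<Otimes>\<^sub>M \<nu>) = sets (B \<Otimes>\<^sub>M B)"
    using prob_measuresD \<mu>\<nu> by (intro sets_pair_measure_cong) auto
  then have "distr \<Omega> (\<mu> \<Otimes>\<^sub>M \<nu>) (\<lambda>z. (f z, g z)) = distr \<Omega> (B \<Otimes>\<^sub>M B) (\<lambda>z. (f z, g z))"
    by (intro distr_cong) auto
  then show "(\<integral>\<^sup>+ z. ennreal ((\<rho> (fst z) (snd z))\<^sup>2) \<partial>distr \<Omega> (\<mu> \<Otimes>\<^sub>M \<nu>) (\<lambda>z. (f z, g z))) \<le> ennreal (A\<^sup>2)"
    using assms(9) by (simp add: nn_integral_distr)
qed

text \<open>Gluing over a one-point set imposes no constraint and yields the independent
  coupling.\<close>

lemma couplings_nonempty: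
  assumes "\<mu> \<in> \<P>" "\<nu> \<in> \<P>"
  shows "couplings \<mu> \<nu> \<noteq> {}"
proof -
  interpret \<mu>: prob_space \<mu> using prob_measuresD[OF assms(1)] by simp
  interpret \<nu>: prob_space \<nu> using prob_measuresD[OF assms(2)] by simp
  have eq: "distr \<mu> (count_space {0}) (\<lambda>_. 0) = distr \<nu> (count_space {0 :: nat}) (\<lambda>_. 0)"
    by (simp add: \<mu>.distr_const \<nu>.distr_const)
  show ?thesis
  proof (rule finite_fibre_coupling[OF \<mu>.prob_space_axioms \<nu>.prob_space_axioms _ _ _ eq])
    fix \<Gamma> assume "sets \<Gamma> = sets (\<mu> \<Otimes>\<^sub>M \<nu>)" "distr \<Gamma> \<mu> fst = \<mu>" "distr \<Gamma> \<nu> snd = \<nu>"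
    then have "\<Gamma> \<in> couplings \<mu> \<nu>" by (simp add: couplings_def)
    then show ?thesis by blast
  qed auto
qed

text \<open>\<open>enn2real\<close> sends infinity to 0, so a bound on the real number says
  something about the infimum only once the infimum is known to be finite. The diameter bound and
  the existence of a coupling ensure this.\<close>

lemma wasserstein2_lessE:
  assumes "\<mu> \<in> \<P>" "\<nu> \<in> \<P>" "W \<mu> \<nu> < A"
  obtains \<pi> where "\<pi> \<in> couplings \<mu> \<nu>" "(\<integral>\<^sup>+ z. ennreal ((\<rho> (fst z) (snd z))\<^sup>2) \<partial>\<pi>) \<le> ennreal (A\<^sup>2)"
proof -
  let ?I = "INF \<pi> \<in> couplings \<mu> \<nu>. \<integral>\<^sup>+ z. ennreal ((\<rho> (fst z) (snd z))\<^sup>2) \<partial>\<pi>"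
  obtain D where D: "0 < D" "\<forall>x\<in>Y. \<forall>y\<in>Y. \<rho> x y \<le> D"
    using metric_bounded by blast
  obtain \<pi> where \<pi>: "\<pi> \<in> couplings \<mu> \<nu>"
    using couplings_nonempty[OF assms(1,2)] by blast
  interpret \<pi>: prob_space \<pi> using couplingsD[OF assms(1,2) \<pi>] by simp
  have "(\<integral>\<^sup>+ z. ennreal ((\<rho> (fst z) (snd z))\<^sup>2) \<partial>\<pi>) \<le> (\<integral>\<^sup>+ z. ennreal (D\<^sup>2) \<partial>\<pi>)"
    using couplingsD(2)[OF assms(1,2) \<pi>] D
    by (intro nn_integral_mono ennreal_leI power_mono) auto
  also have "\<dots> = ennreal (D\<^sup>2)"
    by (simp add: \<pi>.emeasure_space_1)
  finally have "?I \<le> ennreal (D\<^sup>2)"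
    by (rule INF_lower2[OF \<pi>])
  then have fin: "?I = ennreal (enn2real ?I)"
    by (intro ennreal_enn2real[symmetric] le_less_trans[OF _ ennreal_less_top])
  have "sqrt (enn2real ?I) < A"
    using assms(3) by (simp add: wasserstein2_def)
  then have "(sqrt (enn2real ?I))\<^sup>2 < A\<^sup>2"
    by (intro power_strict_mono) auto
  then have "enn2real ?I < A\<^sup>2"
    by simp
  then have "?I < ennreal (A\<^sup>2)"
    by (subst fin) (intro ennreal_lessI le_less_trans[OF enn2real_nonneg])
  then obtain \<pi>' where "\<pi>' \<in> couplings \<mu> \<nu>" "(\<integral>\<^sup>+ z. ennreal ((\<rho> (fst z) (snd z))\<^sup>2) \<partial>\<pi>') < ennreal (A\<^sup>2)"
    unfolding INF_less_iff by blast
  then show thesis using that by (auto intro: less_imp_le)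
qed

lemma wasserstein2_refl:
  assumes "\<mu> \<in> \<P>" shows "W \<mu> \<mu> = 0"
proof -
  have "sets \<mu> = sets B" using prob_measuresD[OF assms] by simp
  then have d: "distr \<mu> B (\<lambda>x. x) = \<mu>" and m: "(\<lambda>x. x) \<in> \<mu> \<rightarrow>\<^sub>M B"
    by (simp_all add: distr_id2 measurable_ident_sets)
  have "(\<integral>\<^sup>+ z. ennreal ((\<rho> z z)\<^sup>2) \<partial>\<mu>) = (\<integral>\<^sup>+ z. 0 \<partial>\<mu>)"
    using prob_measuresD[OF assms] by (intro nn_integral_cong) simp
  then have "W \<mu> \<mu> \<le> 0"
    by (intro wasserstein2_le_distr[OF prob_measuresD(1)[OF assms] m m assms assms d d]) auto
  then show ?thesis using wasserstein2_nonneg[of \<rho> \<mu> \<mu>] by simp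
qed

lemma wasserstein2_triangle:
  assumes "\<mu> \<in> \<P>" "\<nu> \<in> \<P>" "\<kappa> \<in> \<P>" shows "W \<mu> \<kappa> \<le> W \<mu> \<nu> + W \<nu> \<kappa>"
proof (rule field_le_epsilon)
  fix e' :: real assume "0 < e'"
  \<comment> \<open>One share of slack goes to each of the two couplings and two shares to the
    mismatch between middle points lying in the same cell.\<close>
  define e where "e = e' / 4"
  have e: "0 < e" using \<open>0 < e'\<close> by (simp add: e_def)
  have id: "distr \<mu> B id = \<mu>" "distr \<nu> B id = \<nu>" "distr \<kappa> B id = \<kappa>"
    using assms prob_measuresD by (auto intro!: distr_id2 simp: id_def)
  obtain \<pi> where \<pi>: "\<pi> \<in> couplings \<mu> \<nu>"
    "(\<integral>\<^sup>+ z. ennreal ((\<rho> (fst z) (snd z))\<^sup>2) \<partial>\<pi>) \<le> ennreal ((W \<mu> \<nu> + e)\<^sup>2)"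
    using e by (elim wasserstein2_lessE[OF assms(1,2), of "W \<mu> \<nu> + e", rotated]) simp
  obtain \<pi>' where \<pi>': "\<pi>' \<in> couplings \<nu> \<kappa>"
    "(\<integral>\<^sup>+ z. ennreal ((\<rho> (fst z) (snd z))\<^sup>2) \<partial>\<pi>') \<le> ennreal ((W \<nu> \<kappa> + e)\<^sup>2)"
    using e by (elim wasserstein2_lessE[OF assms(2,3), of "W \<nu> \<kappa> + e", rotated]) simp
  note c = couplingsD[OF assms(1,2) \<pi>(1)] and c' = couplingsD[OF assms(2,3) \<pi>'(1)]
  obtain F T where F: "finite F" "F \<subseteq> Y" and T: "T \<in> B \<rightarrow>\<^sub>M count_space F"
    and near: "\<And>x. x \<in> Y \<Longrightarrow> \<rho> x (T x) < e"
    using near_point_map[OF e] by blast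
  have TY: "T x \<in> Y" if "x \<in> Y" for x
    using measurable_space[OF T] F(2) that by auto
  \<comment> \<open>Both couplings have \<open>\<nu>\<close> as their middle marginal, so the middle
    points hit each cell with the same probability. This is the compatibility needed for gluing over
    \<open>F\<close>.\<close>
  have "distr \<pi> (count_space F) (\<lambda>z. T (snd z)) = distr (distr \<pi> B snd) (count_space F) T"
    using T c(9) by (simp add: distr_distr comp_def)
  also have "\<dots> = distr (distr \<pi>' B fst) (count_space F) T"
    by (simp add: c c')
  also have "\<dots> = distr \<pi>' (count_space F) (\<lambda>z. T (fst z))"
    using T c'(8) by (simp add: distr_distr comp_def)
  finally obtain \<Gamma> where \<Gamma>: "sets \<Gamma> = sets (\<pi> \<Otimes>\<^sub>M \<pi>')" "distr \<Gamma> \<pi> fst = \<pi>" "distr \<Gamma> \<pi>' snd = \<pi>'"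
    "AE z in \<Gamma>. T (snd (fst z)) = T (fst (snd z))"
    using finite_fibre_coupling[OF c(3) c'(3) F(1) measurable_compose[OF c(9) T] measurable_compose[OF c'(8) T]]
    by blast
  have [measurable]: "fst \<in> \<Gamma> \<rightarrow>\<^sub>M \<pi>" "snd \<in> \<Gamma> \<rightarrow>\<^sub>M \<pi>'"
    by (simp_all add: measurable_cong_sets[OF \<Gamma>(1) refl])
  have [measurable]: "(\<lambda>z. \<rho> (fst z) (snd z)) \<in> borel_measurable \<pi>" "(\<lambda>z. \<rho> (fst z) (snd z)) \<in> borel_measurable \<pi>'"
    using borel_measurable_metric
    by (simp_all add: measurable_cong_sets[OF c(1) refl] measurable_cong_sets[OF c'(1) refl])
  have space: "space \<Gamma> = (Y \<times> Y) \<times> (Y \<times> Y)"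
    using sets_eq_imp_space_eq[OF \<Gamma>(1)] c(2) c'(2) by (simp add: space_pair_measure)
  interpret \<Gamma>: prob_space \<Gamma>
    using c(3) \<Gamma>(2) by (metis prob_space_distrD \<open>fst \<in> \<Gamma> \<rightarrow>\<^sub>M \<pi>\<close>)
  have m: "(\<lambda>z. fst (fst z)) \<in> \<Gamma> \<rightarrow>\<^sub>M B" "(\<lambda>z. snd (snd z)) \<in> \<Gamma> \<rightarrow>\<^sub>M B"
    using c(8) c'(9) by measurable
  have "distr \<Gamma> B (\<lambda>z. fst (fst z)) = distr (distr \<Gamma> \<pi> fst) B fst"
    using c(8) by (simp add: distr_distr comp_def)
  then have d1: "distr \<Gamma> B (\<lambda>z. fst (fst z)) = \<mu>"
    by (simp add: \<Gamma> c id)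
  have "distr \<Gamma> B (\<lambda>z. snd (snd z)) = distr (distr \<Gamma> \<pi>' snd) B snd"
    using c'(9) by (simp add: distr_distr comp_def)
  then have d2: "distr \<Gamma> B (\<lambda>z. snd (snd z)) = \<kappa>"
    by (simp add: \<Gamma> c' id)
  have "(\<integral>\<^sup>+ z. ennreal ((\<rho> (fst (fst z)) (snd (fst z)))\<^sup>2) \<partial>\<Gamma>) =
      (\<integral>\<^sup>+ z. ennreal ((\<rho> (fst z) (snd z))\<^sup>2) \<partial>distr \<Gamma> \<pi> fst)"
    by (simp add: nn_integral_distr)
  then have i1: "(\<integral>\<^sup>+ z. ennreal ((\<rho> (fst (fst z)) (snd (fst z)))\<^sup>2) \<partial>\<Gamma>) \<le> ennreal ((W \<mu> \<nu> + e)\<^sup>2)"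
    using \<pi>(2) by (simp add: \<Gamma>)
  have "(\<integral>\<^sup>+ z. ennreal ((\<rho> (fst (snd z)) (snd (snd z)))\<^sup>2) \<partial>\<Gamma>) =
      (\<integral>\<^sup>+ z. ennreal ((\<rho> (fst z) (snd z))\<^sup>2) \<partial>distr \<Gamma> \<pi>' snd)"
    by (simp add: nn_integral_distr)
  then have i2: "(\<integral>\<^sup>+ z. ennreal ((\<rho> (fst (snd z)) (snd (snd z)))\<^sup>2) \<partial>\<Gamma>) \<le> ennreal ((W \<nu> \<kappa> + e)\<^sup>2)"
    using \<pi>'(2) by (simp add: \<Gamma>)
  have i3: "(\<integral>\<^sup>+ z. ennreal ((2 * e)\<^sup>2) \<partial>\<Gamma>) \<le> ennreal ((2 * e)\<^sup>2)"
    by (simp add: \<Gamma>.emeasure_space_1)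
  have pos: "0 < W \<mu> \<nu> + e" "0 < W \<nu> \<kappa> + e" "0 < 2 * e" "0 < 2 * e + (W \<nu> \<kappa> + e)"
    using e wasserstein2_nonneg[of \<rho> \<nu> \<kappa>] wasserstein2_nonneg[of \<rho> \<mu> \<nu>] by linarith+
  have i23: "(\<integral>\<^sup>+ z. ennreal ((2 * e + \<rho> (fst (snd z)) (snd (snd z)))\<^sup>2) \<partial>\<Gamma>) \<le> ennreal ((2 * e + (W \<nu> \<kappa> + e))\<^sup>2)"
    using pos e by (intro nn_integral_square_add[OF _ _ _ i3 i2]) auto
  have "AE z in \<Gamma>. 0 \<le> \<rho> (fst (fst z)) (snd (snd z)) \<and> \<rho> (fst (fst z)) (snd (snd z)) \<le>
      \<rho> (fst (fst z)) (snd (fst z)) + (2 * e + \<rho> (fst (snd z)) (snd (snd z)))"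
    using \<Gamma>(4) AE_space
  proof eventually_elim
    case (elim z)
    then obtain a b c d where z: "z = ((a, b), (c, d))" "a \<in> Y" "b \<in> Y" "c \<in> Y" "d \<in> Y"
      by (auto simp: space)
    \<comment> \<open>After gluing the two middle points need not coincide, but both lie within
      \<open>e\<close> of the same net point.\<close>
    have "\<rho> b c \<le> 2 * e"
      using triangle[of b "T b" c] near[of b] near[of c] TY[of b] z elim commute[of c "T c"] by auto
    moreover have "\<rho> a d \<le> \<rho> a b + (\<rho> b c + \<rho> c d)"
      using triangle[of a b d] triangle[of b c d] z by auto
    ultimately show ?case using z by simp
  qed
  then have "(\<integral>\<^sup>+ z. ennreal ((\<rho> (fst (fst z)) (snd (snd z)))\<^sup>2) \<partial>\<Gamma>)
      \<le> ennreal ((W \<mu> \<nu> + e + (2 * e + (W \<nu> \<kappa> + e)))\<^sup>2)"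
    using pos by (intro nn_integral_square_add[OF _ _ _ i1 i23]) auto
  then have "W \<mu> \<kappa> \<le> W \<mu> \<nu> + e + (2 * e + (W \<nu> \<kappa> + e))"
    using pos assms m d1 d2 by (intro wasserstein2_le_distr[OF \<Gamma>.prob_space_axioms m]) auto
  then show "W \<mu> \<kappa> \<le> W \<mu> \<nu> + W \<nu> \<kappa> + e'"
    by (simp add: e_def)
qed

text \<open>By Markov's inequality a cheap coupling rarely moves a point by \<open>r\<close> or
  more, so the mass of \<open>C\<close> under \<open>\<mu>\<close> is at most the mass of its
  \<open>r\<close>-neighbourhood under \<open>\<nu>\<close> plus a small error. As \<open>r\<close>
  shrinks, the neighbourhoods decrease to \<open>C\<close> because \<open>C\<close> is
  closed.\<close>

lemma closedin_measure_le:
  assumes "\<mu> \<in> \<P>" "\<nu> \<in> \<P>" "W \<mu> \<nu> = 0" and C: "closedin mtopology C"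
  shows "measure \<mu> C \<le> measure \<nu> C"
proof -
  interpret \<mu>: prob_space \<mu> using prob_measuresD[OF assms(1)] by simp
  interpret \<nu>: prob_space \<nu> using prob_measuresD[OF assms(2)] by simp
  have sets: "sets \<mu> = sets B" "sets \<nu> = sets B"
    using assms prob_measuresD by auto
  have CY: "C \<subseteq> Y" using closedin_subset[OF C] by simp
  define N where "N r = (\<Union>x\<in>C. mball x r)" for r
  have N[measurable]: "N r \<in> sets B" for r
    unfolding N_def by (intro openin_sets_B openin_Union) auto
  have C'[measurable]: "C \<in> sets B" using C by (rule closedin_sets_B)
  have le: "measure \<mu> C \<le> measure \<nu> (N r)" if r: "0 < r" for r
  proof (rule field_le_epsilon)
    fix e :: real assume e: "0 < e"
    \<comment> \<open>The tolerance \<open>r * sqrt e\<close> is tuned so that Markov's inequality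
      at level \<open>r\<^sup>2\<close> leaves exactly the probability \<open>e\<close>.\<close>
    obtain \<pi> where \<pi>: "\<pi> \<in> couplings \<mu> \<nu>"
      "(\<integral>\<^sup>+ z. ennreal ((\<rho> (fst z) (snd z))\<^sup>2) \<partial>\<pi>) \<le> ennreal ((r * sqrt e)\<^sup>2)"
      using e r assms(3) by (elim wasserstein2_lessE[OF assms(1,2), of "r * sqrt e", rotated]) simp
    note c = couplingsD[OF assms(1,2) \<pi>(1)]
    interpret \<pi>: prob_space \<pi> using c by simp
    have [measurable]: "(\<lambda>z. \<rho> (fst z) (snd z)) \<in> borel_measurable \<pi>" "fst \<in> \<pi> \<rightarrow>\<^sub>M B" "snd \<in> \<pi> \<rightarrow>\<^sub>M B"
      using borel_measurable_metric c by (simp_all add: measurable_cong_sets[OF c(1) refl])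
    define E where "E = {z \<in> space \<pi>. r \<le> \<rho> (fst z) (snd z)}"
    have [measurable]: "E \<in> sets \<pi>" unfolding E_def by measurable
    have "ennreal (r\<^sup>2) * emeasure \<pi> E = (\<integral>\<^sup>+ z. ennreal (r\<^sup>2) * indicator E z \<partial>\<pi>)"
      by (simp add: nn_integral_cmult_indicator)
    also have "\<dots> \<le> (\<integral>\<^sup>+ z. ennreal ((\<rho> (fst z) (snd z))\<^sup>2) \<partial>\<pi>)"
      using r by (intro nn_integral_mono) (auto simp: E_def indicator_def intro!: ennreal_leI power_mono)
    also have "\<dots> \<le> ennreal (r\<^sup>2 * e)"
      using \<pi>(2) e by (simp add: power_mult_distrib)
    finally have "r\<^sup>2 * measure \<pi> E \<le> r\<^sup>2 * e"
      using e by (simp add: \<pi>.emeasure_eq_measure flip: ennreal_mult)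
    then have E: "measure \<pi> E \<le> e" using r by simp
    have "measure \<mu> C = measure (distr \<pi> \<mu> fst) C"
      by (simp add: c)
    also have "\<dots> = measure \<pi> (fst -` C \<inter> space \<pi>)"
      using c(8) sets C' by (intro measure_distr) (simp_all add: measurable_cong_sets[OF refl sets(1)])
    also have "\<dots> \<le> measure \<pi> ((snd -` N r \<inter> space \<pi>) \<union> E)"
    proof (rule \<pi>.finite_measure_mono)
      show "fst -` C \<inter> space \<pi> \<subseteq> (snd -` N r \<inter> space \<pi>) \<union> E"
        using CY by (auto simp: N_def E_def c(2)) (meson not_le)
    qed measurable
    also have "\<dots> \<le> measure \<pi> (snd -` N r \<inter> space \<pi>) + measure \<pi> E"
      by (intro measure_Un_le) auto
    also have "measure \<pi> (snd -` N r \<inter> space \<pi>) = measure (distr \<pi> \<nu> snd) (N r)"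
      using c(9) sets N by (intro measure_distr[symmetric]) (simp_all add: measurable_cong_sets[OF refl sets(2)])
    also have "\<dots> = measure \<nu> (N r)" by (simp add: c)
    finally show "measure \<mu> C \<le> measure \<nu> (N r) + e" using E by simp
  qed
  have Int: "(\<Inter>n. N (inverse (real (Suc n)))) = C"
  proof (intro equalityI subsetI)
    fix x assume x: "x \<in> (\<Inter>n. N (inverse (real (Suc n))))"
    then have xY: "x \<in> Y" by (auto simp: N_def)
    show "x \<in> C"
    proof (rule ccontr)
      assume "x \<notin> C"
      then have "x \<in> Y - C" "openin mtopology (Y - C)" using xY C by (auto simp: closedin_def)
      then obtain r where r: "0 < r" "mball x r \<subseteq> Y - C"
        by (meson openin_mtopology)
      obtain n where "inverse (real (Suc n)) < r" using reals_Archimedean[OF r(1)] by blast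
      moreover from x obtain y where "y \<in> C" "\<rho> y x < inverse (real (Suc n))"
        by (auto simp: N_def)
      ultimately have "y \<in> mball x r" using CY xY by (auto simp: commute)
      then show False using r \<open>y \<in> C\<close> by auto
    qed
  next
    fix x assume "x \<in> C"
    then show "x \<in> (\<Inter>n. N (inverse (real (Suc n))))"
      using CY by (auto simp: N_def intro!: bexI[of _ x])
  qed
  have "(\<lambda>n. measure \<nu> (N (inverse (real (Suc n))))) \<longlonglongrightarrow> measure \<nu> (\<Inter>n. N (inverse (real (Suc n))))"
  proof (intro \<nu>.finite_Lim_measure_decseq)
    show "decseq (\<lambda>n. N (inverse (real (Suc n))))"
      unfolding decseq_def N_def
      by (intro allI impI UN_mono order_refl mball_subset_concentric le_imp_inverse_le) auto
    show "range (\<lambda>n. N (inverse (real (Suc n)))) \<subseteq> sets \<nu>"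
      using N unfolding sets(2) by blast
  qed
  then show ?thesis
    unfolding Int by (rule LIMSEQ_le_const) (auto intro!: le)
qed

text \<open>By symmetry closed sets have equal mass, by complementation so do open sets, and these
  form an intersection-stable generator of the Borel sets.\<close>

lemma wasserstein2_eq_0:
  assumes "\<mu> \<in> \<P>" "\<nu> \<in> \<P>" "W \<mu> \<nu> = 0" shows "\<mu> = \<nu>"
proof -
  interpret \<mu>: prob_space \<mu> using prob_measuresD[OF assms(1)] by simp
  interpret \<nu>: prob_space \<nu> using prob_measuresD[OF assms(2)] by simp
  note \<mu> = prob_measuresD[OF assms(1)] and \<nu> = prob_measuresD[OF assms(2)]
  have "W \<nu> \<mu> = 0"
    using assms(3) wasserstein2_commute[of \<rho> \<nu> \<mu>] commute by simp
  then have closed: "measure \<mu> C = measure \<nu> C" if "closedin mtopology C" for C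
    using closedin_measure_le assms that by (intro order_antisym) auto
  have op: "measure \<mu> U = measure \<nu> U" if U: "openin mtopology U" for U
  proof -
    have "measure \<mu> (space \<mu> - U) = measure \<nu> (space \<nu> - U)"
      using closed[of "topspace mtopology - U"] U \<mu> \<nu> by (simp add: closedin_diff)
    then show ?thesis
      using \<mu>.prob_compl[of U] \<nu>.prob_compl[of U] openin_sets_B[OF U] \<mu> \<nu> by simp
  qed
  show ?thesis
  proof (rule measure_eqI_generator_eq[where \<Omega> = Y and A = "\<lambda>_. Y"])
    show "Int_stable {U. openin mtopology U}" by (auto simp: Int_stable_def)
    show "{U. openin mtopology U} \<subseteq> Pow Y" using openin_subset by fastforce
    show "emeasure \<mu> U = emeasure \<nu> U" if "U \<in> {U. openin mtopology U}" for U
      using op that by (simp add: \<mu>.emeasure_eq_measure \<nu>.emeasure_eq_measure)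
    have "openin mtopology Y"
      using openin_topspace[of mtopology] by simp
    then show "range (\<lambda>_. Y) \<subseteq> {U. openin mtopology U}" by auto
  qed (use \<mu> \<nu> sets_B in auto)
qed

lemma Metric_space_wasserstein2: "Metric_space \<P> W"
proof
  show "W \<mu> \<nu> = W \<nu> \<mu>" for \<mu> \<nu>
    using commute by (rule wasserstein2_commute)
qed (auto simp: wasserstein2_triangle wasserstein2_eq_0 wasserstein2_refl)

end

subsection \<open>Compactness and empirical measures\<close>

text \<open>The average is the law of \<open>x\<close> at a uniformly random index. Integrals and
  push-forwards of averages thereby reduce to those of \<open>distr\<close>.\<close>

lemma dirac_average_eq_distr:
  assumes "1 \<le> n" and x: "\<And>j. j \<in> {1..n} \<Longrightarrow> x j \<in> space B"
  shows "dirac_average B n x = distr (point_measure {1..n} (\<lambda>_. 1 / ennreal (real n))) B x"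
    (is "_ = distr ?U B x")
proof (rule measure_eqI)
  have sets: "sets (dirac_average B n x) = sets B"
    by (simp add: dirac_average_def)
  then show "sets (dirac_average B n x) = sets (distr ?U B x)" by simp
  fix A assume "A \<in> sets (dirac_average B n x)"
  then have A: "A \<in> sets B" using sets by simp
  have m: "x \<in> ?U \<rightarrow>\<^sub>M B"
    using x by (auto simp: measurable_def space_point_measure sets_point_measure)
  have "emeasure (distr ?U B x) A = (\<integral>\<^sup>+ y. indicator A y \<partial>distr ?U B x)"
    using A by simp
  also have "\<dots> = (\<integral>\<^sup>+ j. indicator A (x j) \<partial>?U)"
    using m A by (intro nn_integral_distr) auto
  also have "\<dots> = (\<Sum>j=1..n. 1 / ennreal (real n) * indicator A (x j))"
    by (intro nn_integral_point_measure_finite) auto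
  finally show "emeasure (dirac_average B n x) A = emeasure (distr ?U B x) A"
    using A by (simp add: emeasure_dirac_average divide_ennreal_def mult.commute flip: sum_distrib_left
        del: sum_indicator_eq_card)
qed

lemma nn_integral_dirac_average:
  assumes n: "1 \<le> n" and x: "\<And>j. j \<in> {1..n} \<Longrightarrow> x j \<in> space B"
    and f: "f \<in> borel_measurable B"
  shows "(\<integral>\<^sup>+ y. f y \<partial>dirac_average B n x) = (\<Sum>j=1..n. f (x j)) / ennreal (real n)"
proof -
  have m: "x \<in> point_measure {1..n} w \<rightarrow>\<^sub>M B" for w
    using x by (auto simp: measurable_def space_point_measure sets_point_measure)
  have eq: "dirac_average B n x = distr (point_measure {1..n} (\<lambda>_. 1 / ennreal (real n))) B x"
    using n x by (rule dirac_average_eq_distr)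
  show ?thesis
    unfolding eq by (subst nn_integral_distr[OF m])
      (use f in \<open>auto simp: nn_integral_point_measure_finite divide_ennreal_def mult.commute
        simp flip: sum_distrib_right\<close>)
qed

lemma space_dirac_average [simp]: "space (dirac_average B n x) = space B"
  and sets_dirac_average [simp]: "sets (dirac_average B n x) = sets B"
  by (simp_all add: dirac_average_def)

lemma prob_space_dirac_average:
  assumes n: "1 \<le> n" and x: "\<And>j. j \<in> {1..n} \<Longrightarrow> x j \<in> space B"
  shows "prob_space (dirac_average B n x)"
proof
  have "emeasure (dirac_average B n x) (space B) = of_nat n / ennreal (real n)"
    using x by (simp add: emeasure_dirac_average)
  also have "\<dots> = 1"
    using n by (simp add: ennreal_of_nat_eq_real_of_nat divide_ennreal)
  finally show "emeasure (dirac_average B n x) (space (dirac_average B n x)) = 1" by simp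
qed

lemma measure_dirac_average:
  assumes "1 \<le> n" "A \<in> sets B"
  shows "measure (dirac_average B n x) A = (\<Sum>j=1..n. indicator A (x j)) / real n"
proof -
  have "(\<Sum>j=1..n. indicator A (x j) :: ennreal) = ennreal (\<Sum>j=1..n. indicator A (x j))"
    by (simp add: ennreal_indicator flip: sum_ennreal)
  then have "emeasure (dirac_average B n x) A = ennreal ((\<Sum>j=1..n. indicator A (x j)) / real n)"
    using assms by (simp add: emeasure_dirac_average divide_ennreal sum_nonneg)
  then show ?thesis
    by (simp add: measure_def sum_nonneg)
qed

lemma distr_dirac_average:
  assumes n: "1 \<le> n" and x: "\<And>j. j \<in> {1..n} \<Longrightarrow> x j \<in> space B" and f: "f \<in> B \<rightarrow>\<^sub>M C"
  shows "distr (dirac_average B n x) C f = dirac_average C n (\<lambda>j. f (x j))"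
proof -
  have m: "x \<in> point_measure {1..n} w \<rightarrow>\<^sub>M B" for w
    using x by (auto simp: measurable_def space_point_measure sets_point_measure)
  have fx: "f (x j) \<in> space C" if "j \<in> {1..n}" for j
    using measurable_space[OF f x[OF that]] .
  have "dirac_average B n x = distr (point_measure {1..n} (\<lambda>_. 1 / ennreal (real n))) B x"
    using n x by (rule dirac_average_eq_distr)
  moreover have "dirac_average C n (\<lambda>j. f (x j)) =
      distr (point_measure {1..n} (\<lambda>_. 1 / ennreal (real n))) C (\<lambda>j. f (x j))"
    using n fx by (rule dirac_average_eq_distr)
  ultimately show ?thesis
    using distr_distr[OF f m] by (simp add: comp_def)
qed

text \<open>The metric axioms for \<open>W\<close> make distances to the members of \<open>S\<close>
  Borel measurable on the space of measures; the integral against an average of point masses is then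
  a finite sum.\<close>

lemma (in totally_bounded_metric_space) kmeans_cost_wasserstein2:
  assumes "1 \<le> m" and \<alpha>: "\<And>i. i \<in> {1..m} \<Longrightarrow> \<alpha> i \<in> \<P>" and S: "S \<in> finite_subsets_upto \<P> k"
  shows "kmeans_cost W (dirac_average (metric_borel \<P> W) m \<alpha>) p S =
    ennreal ((\<Sum>i=1..m. Min ((\<lambda>x. W (\<alpha> i) x powr p) ` S)) / real m)"
proof -
  have S': "finite S" "S \<noteq> {}" "S \<subseteq> \<P>"
    using S by (auto simp: finite_subsets_upto_def)
  have [measurable]: "(\<lambda>y. W y x) \<in> borel_measurable (metric_borel \<P> W)" if "x \<in> S" for x
    using borel_measurable_metric_borel_dist[OF Metric_space_wasserstein2] that S' by blast
  have nn: "0 \<le> Min ((\<lambda>x. W y x powr p) ` S)" for y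
    using S' by (intro Min.boundedI) auto
  have "(\<lambda>y. Min ((\<lambda>x. W y x powr p) ` S)) \<in> borel_measurable (metric_borel \<P> W)"
    using S' by (intro borel_measurable_Min) auto
  then have "kmeans_cost W (dirac_average (metric_borel \<P> W) m \<alpha>) p S =
      (\<Sum>i=1..m. ennreal (Min ((\<lambda>x. W (\<alpha> i) x powr p) ` S))) / ennreal (real m)"
    unfolding kmeans_cost_def using assms
    by (intro nn_integral_dirac_average) (auto simp: space_metric_borel[OF Metric_space_wasserstein2])
  also have "\<dots> = ennreal ((\<Sum>i=1..m. Min ((\<lambda>x. W (\<alpha> i) x powr p) ` S)) / real m)"
    using assms nn by (simp add: divide_ennreal sum_nonneg)
  finally show ?thesis .
qed

section \<open>From weak convergence of coded measures to Wasserstein convergence\<close>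

lemma compact_totally_bounded_metric_space:
  assumes "compact (UNIV :: 'a::metric_space set)"
  shows "totally_bounded_metric_space (UNIV :: 'a set) dist"
proof -
  have "\<exists>K\<subseteq>UNIV. finite K \<and> (UNIV :: 'a set) \<subseteq> (\<Union>x\<in>K. ball x e)" if "0 < e" for e
    using assms[unfolded compact_eq_totally_bounded] that by auto
  then have "Met_TC.mtotally_bounded (UNIV :: 'a set)"
    unfolding Met_TC.mtotally_bounded_def by auto
  then show ?thesis
    by (intro totally_bounded_metric_space.intro totally_bounded_metric_space_axioms.intro
        Met_TC.Metric_space_axioms)
qed

lemma finite_totally_bounded_metric_space:
  assumes "Metric_space Y \<rho>" "finite Y"
  shows "totally_bounded_metric_space Y \<rho>"
  using assms Metric_space.finite_imp_mtotally_bounded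
  by (intro totally_bounded_metric_space.intro totally_bounded_metric_space_axioms.intro) auto

text \<open>The continuous inverse lives only on the closure \<open>K\<close> of the codes. Off
  \<open>K\<close> a constant value is used, which keeps \<open>h\<close> Borel on the whole line
  while continuity is claimed on \<open>K\<close> alone.\<close>

lemma compact_coding_continuous_inverse:
  assumes "compact (UNIV :: 'a set)"
  obtains s :: "'a::metric_space \<Rightarrow> real" and h K
  where "s \<in> borel_measurable borel" "\<And>x. 0 \<le> s x" "\<And>x. s x \<le> 1" "closed K" "\<And>x. s x \<in> K"
    "continuous_on K h" "h \<in> borel_measurable borel" "\<And>x. h (s x) = x"
proof -
  obtain s :: "'a \<Rightarrow> real" where s: "s \<in> borel_measurable borel" "\<And>x. 0 \<le> s x" "\<And>x. s x \<le> 1"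
    "\<And>e. 0 < e \<Longrightarrow> \<exists>\<delta>>0. \<forall>x y. \<bar>s x - s y\<bar> < \<delta> \<longrightarrow> dist x y < e"
    using compact_coding[OF assms] by metis
  obtain g where g: "continuous_on (closure (range s)) g" "\<And>x. g (s x) = x"
    using uniform_left_inverse_extension[OF assms s(4)] by metis
  define K where "K = closure (range s)"
  have sK: "s x \<in> K" for x
    unfolding K_def by (rule subsetD[OF closure_subset]) simp
  define h where "h t = (if t \<in> K then g t else undefined)" for t
  have "h \<in> borel_measurable borel"
    unfolding h_def[abs_def]
    by (rule borel_measurable_continuous_on_if) (use g in \<open>auto simp: K_def\<close>)
  moreover have "continuous_on K h"
    using g(1) by (simp add: h_def K_def cong: continuous_on_cong)
  moreover have "closed K" by (simp add: K_def)
  moreover have "h (s x) = x" for x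
    by (simp add: h_def sK g)
  ultimately show thesis
    using that s(1-3) sK by blast
qed

text \<open>The limit \<open>N\<close> may charge points of \<open>K\<close> outside the range of
  \<open>s\<close>, so it need not be a coded measure. The limit on \<open>X\<close> is therefore
  defined as the image of \<open>N\<close> under \<open>h\<close>.\<close>

lemma wasserstein2_tendsto_of_weak_conv:
  fixes \<mu> :: "nat \<Rightarrow> 'a::metric_space measure" and h :: "real \<Rightarrow> 'a"
  assumes cpt: "compact (UNIV :: 'a set)"
    and \<mu>: "\<And>n. \<mu> n \<in> prob_measures UNIV dist"
    and [measurable]: "s \<in> borel_measurable borel" "h \<in> borel_measurable borel"
    and K: "closed K" "\<And>x. s x \<in> K" "continuous_on K h" "\<And>x. h (s x) = x"
    and N: "real_distribution N" "weak_conv_m (\<lambda>n. distr (\<mu> n) borel s) N"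
  shows "distr N borel h \<in> prob_measures UNIV dist"
    and "(\<lambda>n. wasserstein2 dist (\<mu> n) (distr N borel h)) \<longlonglongrightarrow> 0"
proof -
  interpret totally_bounded_metric_space "UNIV :: 'a set" dist
    by (rule compact_totally_bounded_metric_space[OF cpt])
  have [simp]: "metric_borel (UNIV :: 'a set) dist = borel"
    by (rule metric_borel_UNIV_dist)
  interpret N: real_distribution N by fact
  have \<mu>': "prob_space (\<mu> n)" "sets (\<mu> n) = sets borel" "space (\<mu> n) = UNIV" for n
    using \<mu>[of n] by (auto simp: prob_measures_def)
  have [measurable_cong]: "sets (\<mu> n) = sets borel" for n
    by (rule \<mu>')
  have d: "real_distribution (distr (\<mu> n) borel s)" for n
  proof -
    interpret prob_space "\<mu> n" by (rule \<mu>')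
    show ?thesis by (rule real_distribution_distr) measurable
  qed
  obtain \<Omega> :: "real measure" and Z :: "nat \<Rightarrow> real \<Rightarrow> real" and Z' where
    sk: "prob_space \<Omega> \<and> (\<forall>n. Z n \<in> measurable \<Omega> borel) \<and>
      (\<forall>n. distr \<Omega> borel (Z n) = distr (\<mu> n) borel s) \<and> Z' \<in> measurable \<Omega> lborel \<and>
      distr \<Omega> borel Z' = N \<and> (\<forall>x\<in>space \<Omega>. (\<lambda>n. Z n x) \<longlonglongrightarrow> Z' x)"
    using Skorohod[OF d N] by blast
  then have \<Omega>: "prob_space \<Omega>" and [measurable]: "\<And>n. Z n \<in> borel_measurable \<Omega>" "Z' \<in> borel_measurable \<Omega>"
    and dZ: "\<And>n. distr \<Omega> borel (Z n) = distr (\<mu> n) borel s" and dZ': "distr \<Omega> borel Z' = N"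
    and lim: "\<And>x. x \<in> space \<Omega> \<Longrightarrow> (\<lambda>n. Z n x) \<longlonglongrightarrow> Z' x"
    by simp_all
  interpret \<Omega>: prob_space \<Omega> by fact
  \<comment> \<open>\<open>Z n\<close> has the law of a coded point, hence almost surely takes
    values in \<open>K\<close>; since \<open>K\<close> is closed the limit \<open>Z'\<close> stays
    there too, where \<open>h\<close> is continuous.\<close>
  have "AE x in \<Omega>. Z n x \<in> K" for n
  proof -
    have K': "{t \<in> space borel. t \<in> K} \<in> sets borel"
      using K(1) by (simp add: borel_closed)
    have "AE t in distr (\<mu> n) borel s. t \<in> K"
      using K' by (subst AE_distr_iff) (auto simp: K)
    then have "AE t in distr \<Omega> borel (Z n). t \<in> K"
      unfolding dZ .
    then show ?thesis
      using K' by (subst (asm) AE_distr_iff) auto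
  qed
  then have ZK: "AE x in \<Omega>. \<forall>n. Z n x \<in> K"
    by (simp add: AE_all_countable)
  have conv: "AE x in \<Omega>. (\<lambda>n. h (Z n x)) \<longlonglongrightarrow> h (Z' x)"
    using ZK AE_space
  proof eventually_elim
    case (elim x)
    then have "Z' x \<in> K"
      using closed_sequentially[OF K(1) _ lim[of x]] by simp
    with elim show ?case
      by (intro continuous_on_tendsto_compose[OF K(3)] lim) auto
  qed
  have prob: "distr \<Omega> borel (\<lambda>x. h (Z' x)) = distr N borel h"
    unfolding dZ'[symmetric] by (subst distr_distr) (auto simp: comp_def)
  show NP: "distr N borel h \<in> prob_measures UNIV dist"
    by (auto simp: prob_measures_def intro!: N.prob_space_distr)
  \<comment> \<open>\<open>h\<close> undoes \<open>s\<close>, so the representatives mapped back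
    have the original laws without any error.\<close>
  have law: "distr \<Omega> borel (\<lambda>x. h (Z n x)) = \<mu> n" for n
  proof -
    have "distr \<Omega> borel (\<lambda>x. h (Z n x)) = distr (distr \<Omega> borel (Z n)) borel h"
      by (subst distr_distr) (auto simp: comp_def)
    also have "\<dots> = distr (\<mu> n) borel (\<lambda>x. x)"
      unfolding dZ by (subst distr_distr) (auto simp: comp_def K)
    finally show ?thesis using \<mu>' by (simp add: distr_id2)
  qed
  define c where "c n = (\<integral>\<^sup>+ x. ennreal ((dist (h (Z n x)) (h (Z' x)))\<^sup>2) \<partial>\<Omega>)" for n
  obtain D where D: "0 < D" "\<forall>x\<in>UNIV. \<forall>y\<in>UNIV. dist x (y::'a) \<le> D"
    using metric_bounded by blast
  have pd: "(\<lambda>z. dist (fst z) (snd z) :: real) \<in> borel_measurable (borel \<Otimes>\<^sub>M (borel :: 'a measure))"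
    using borel_measurable_metric by simp
  have m[measurable]: "(\<lambda>x. dist (h (Z n x)) (h (Z' x))) \<in> borel_measurable \<Omega>" for n
  proof -
    have "(\<lambda>x. (h (Z n x), h (Z' x))) \<in> \<Omega> \<rightarrow>\<^sub>M borel \<Otimes>\<^sub>M borel" by measurable
    from measurable_compose[OF this pd] show ?thesis by simp
  qed
  have "c \<longlonglongrightarrow> (\<integral>\<^sup>+ x. 0 \<partial>\<Omega>)"
    unfolding c_def
  proof (rule nn_integral_dominated_convergence[where w = "\<lambda>_. ennreal (D\<^sup>2)"])
    show "AE x in \<Omega>. ennreal ((dist (h (Z n x)) (h (Z' x)))\<^sup>2) \<le> ennreal (D\<^sup>2)" for n
      using D by (intro AE_I2 ennreal_leI power_mono) auto
    show "AE x in \<Omega>. (\<lambda>n. ennreal ((dist (h (Z n x)) (h (Z' x)))\<^sup>2)) \<longlonglongrightarrow> 0"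
      using conv
    proof eventually_elim
      case (elim x)
      have "(\<lambda>n. (dist (h (Z n x)) (h (Z' x)))\<^sup>2) \<longlonglongrightarrow> 0\<^sup>2"
        by (intro tendsto_power) (use elim in \<open>simp flip: tendsto_dist_iff\<close>)
      from tendsto_ennrealI[OF this] show ?case by simp
    qed
  qed (auto simp: \<Omega>.emeasure_space_1)
  then have c0: "c \<longlonglongrightarrow> ennreal 0" by simp
  have fin: "c n = ennreal ((sqrt (enn2real (c n)))\<^sup>2)" for n
  proof -
    have "c n \<le> (\<integral>\<^sup>+ x. ennreal (D\<^sup>2) \<partial>\<Omega>)"
      unfolding c_def using D by (intro nn_integral_mono ennreal_leI power_mono) auto
    also have "\<dots> < top" by (simp add: \<Omega>.emeasure_space_1)
    finally show ?thesis by simp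
  qed
  have le: "wasserstein2 dist (\<mu> n) (distr N borel h) \<le> sqrt (enn2real (c n))" for n
    using fin[of n]
    by (intro wasserstein2_le_distr[OF \<Omega>, of "\<lambda>x. h (Z n x)" "\<lambda>x. h (Z' x)"])
      (auto simp: \<mu> NP law prob c_def)
  have lim0: "(\<lambda>n. sqrt (enn2real (c n))) \<longlonglongrightarrow> 0"
    using tendsto_real_sqrt[OF tendsto_enn2real[OF c0 order_refl]] by simp
  have "norm (wasserstein2 dist (\<mu> n) (distr N borel h)) \<le> sqrt (enn2real (c n))" for n
    using le[of n] by simp
  then show "(\<lambda>n. wasserstein2 dist (\<mu> n) (distr N borel h)) \<longlonglongrightarrow> 0"
    by (rule Lim_null_comparison[OF always_eventually[OF allI] lim0])
qed

lemma wasserstein2_seq_compact: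
  fixes \<mu> :: "nat \<Rightarrow> 'a::metric_space measure"
  assumes cpt: "compact (UNIV :: 'a set)" and \<mu>: "\<And>n. \<mu> n \<in> prob_measures UNIV dist"
  obtains r \<nu> where "strict_mono (r :: nat \<Rightarrow> nat)" "\<nu> \<in> prob_measures UNIV dist"
    "(\<lambda>n. wasserstein2 dist (\<mu> (r n)) \<nu>) \<longlonglongrightarrow> 0"
proof -
  obtain s :: "'a \<Rightarrow> real" and h K where s: "s \<in> borel_measurable borel" "\<And>x. 0 \<le> s x" "\<And>x. s x \<le> 1"
    and K: "closed K" "\<And>x. s x \<in> K" "continuous_on K h" "h \<in> borel_measurable borel" "\<And>x. h (s x) = x"
    by (rule compact_coding_continuous_inverse[OF cpt]) blast
  have \<mu>': "prob_space (\<mu> n)" "sets (\<mu> n) = sets borel" "space (\<mu> n) = UNIV" for n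
    using \<mu>[of n] by (auto simp: prob_measures_def metric_borel_UNIV_dist)
  have [measurable]: "s \<in> borel_measurable (\<mu> n)" for n
    using s(1) by (simp add: measurable_cong_sets[OF \<mu>'(2) refl])
  have "tight (\<lambda>n. distr (\<mu> n) borel s)"
    unfolding tight_def
  proof (intro conjI allI impI)
    fix n
    interpret prob_space "\<mu> n" by (rule \<mu>')
    show "real_distribution (distr (\<mu> n) borel s)"
      by (rule real_distribution_distr) measurable
  next
    fix \<epsilon> :: real assume "0 < \<epsilon>"
    \<comment> \<open>Codes lie in [0, 1], which makes tightness immediate. Tightness uses intervals
      open on the left, so the left end is moved to -1 in order to keep the code 0.\<close>
    have "measure (distr (\<mu> n) borel s) {-1<..1} = 1" for n
    proof -
      interpret prob_space "\<mu> n" by (rule \<mu>')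
      have "-1 < s x" for x using s(2)[of x] by simp
      then have "s -` {-1<..1} \<inter> space (\<mu> n) = space (\<mu> n)"
        using s(3) by auto
      then show ?thesis by (simp add: measure_distr prob_space)
    qed
    then show "\<exists>a b. a < b \<and> (\<forall>n. 1 - \<epsilon> < measure (distr (\<mu> n) borel s) {a<..b})"
      using \<open>0 < \<epsilon>\<close> by (intro exI[of _ "-1"] exI[of _ 1]) auto
  qed
  from tight_imp_convergent_subsubsequence[OF this strict_mono_id]
  obtain r N where r: "strict_mono (r :: nat \<Rightarrow> nat)" "real_distribution N"
    "weak_conv_m (\<lambda>n. distr (\<mu> (r n)) borel s) N"
    by (auto simp: comp_def)
  show thesis
    using wasserstein2_tendsto_of_weak_conv[of "\<lambda>n. \<mu> (r n)", OF cpt \<mu> s(1) K(4) K(1-3,5) r(2,3)] r(1) that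
    by blast
qed

section \<open>Almost sure convergence of empirical measures\<close>

text \<open>Indicators are bounded, so the deviation probabilities decay geometrically in the sample
  size and Borel-Cantelli applies along the full sequence. The shift by one keeps the empty sample
  out of the average.\<close>

lemma (in prob_space) strong_law_indicator:
  assumes indep: "indep_vars (\<lambda>_. N) X {1..}" and distr: "\<And>j. 1 \<le> j \<Longrightarrow> distr M N (X j) = \<alpha>"
    and A: "A \<in> sets N"
  shows "AE \<omega> in M. (\<lambda>n. (\<Sum>j=1..Suc n. indicator A (X j \<omega>)) / real (Suc n)) \<longlonglongrightarrow> measure \<alpha> A"
proof -
  have X[measurable]: "X j \<in> M \<rightarrow>\<^sub>M N" if "1 \<le> j" for j
    using indep that by (auto simp: indep_vars_def)
  have I: "(indicator A :: _ \<Rightarrow> real) \<in> borel_measurable N"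
    using A by simp
  define \<xi> where "\<xi> j \<omega> = (indicator A (X j \<omega>) :: real)" for j \<omega>
  have \<xi>m[measurable]: "\<xi> j \<in> borel_measurable M" if "1 \<le> j" for j
    unfolding \<xi>_def using measurable_compose[OF X[OF that] I] .
  have \<xi>i: "indep_vars (\<lambda>_. borel) \<xi> {1..Suc n}" for n
    unfolding \<xi>_def by (rule indep_vars_compose2[OF indep_vars_subset[OF indep] I]) auto
  have \<xi>d: "distr M borel (\<xi> j) = distr \<alpha> borel (indicator A)" if "1 \<le> j" for j
  proof -
    have "distr M borel (\<xi> j) = distr (distr M N (X j)) borel (indicator A)"
      using X[OF that] I by (simp add: distr_distr \<xi>_def[abs_def] comp_def)
    then show ?thesis unfolding distr[OF that] .
  qed
  have \<xi>e: "expectation (\<xi> 1) = measure \<alpha> A"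
  proof -
    have "expectation (\<xi> 1) = expectation (indicator (X 1 -` A \<inter> space M))"
      by (intro Bochner_Integration.integral_cong) (auto simp: \<xi>_def indicator_def)
    also have "\<dots> = prob (X 1 -` A \<inter> space M)"
      using X[of 1] A by (simp add: measurable_sets)
    also have "\<dots> = measure (distr M N (X 1)) A"
      using X[of 1] A by (intro measure_distr[symmetric]) auto
    finally show ?thesis by (simp add: distr)
  qed
  have ev: "AE \<omega> in M. \<forall>\<^sub>F n in sequentially.
      \<bar>(\<Sum>j=1..Suc n. \<xi> j \<omega>) / real (Suc n) - measure \<alpha> A\<bar> < e" if e: "0 < e" for e
  proof -
    define E where "E n = {\<omega> \<in> space M. e \<le> \<bar>(\<Sum>j=1..Suc n. \<xi> j \<omega>) / real (Suc n) - measure \<alpha> A\<bar>}" for n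
    have E[measurable]: "E n \<in> sets M" for n
      unfolding E_def by measurable
    have "prob (E n) \<le> 2 * exp (- 2 * e\<^sup>2) ^ Suc n" for n
    proof -
      interpret H: Hoeffding_ineq_iid M "{1..Suc n}" \<xi> "\<xi> 1" 0 1 "measure \<alpha> A"
      proof unfold_locales
        show "indep_vars (\<lambda>_. borel) \<xi> {1..Suc n}" by (rule \<xi>i)
        show "distr M borel (\<xi> i) = distr M borel (\<xi> 1)" if "i \<in> {1..Suc n}" for i
          using \<xi>d[of i] \<xi>d[of 1] that by simp
        show "AE x in M. \<xi> 1 x \<in> {0..1}"
          by (auto simp: \<xi>_def indicator_def)
        show "measure \<alpha> A \<equiv> expectation (\<xi> 1)"
          using \<xi>e by simp
      qed auto
      have "prob (E n) \<le> 2 * exp (- 2 * real (Suc n) * e\<^sup>2)"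
        using H.Hoeffding_ineq_abs_ge'[of e] e by (simp add: E_def)
      also have "exp (- 2 * real (Suc n) * e\<^sup>2) = exp (- 2 * e\<^sup>2) ^ Suc n"
        unfolding exp_of_nat_mult[symmetric] by (simp add: algebra_simps)
      finally show ?thesis .
    qed
    moreover have "summable (\<lambda>n. 2 * exp (- 2 * e\<^sup>2) ^ Suc n)"
      using e by (intro summable_mult iffD2[OF summable_Suc_iff] summable_geometric) auto
    ultimately have "summable (\<lambda>n. prob (E n))"
      by (auto intro: summable_comparison_test'[of "\<lambda>n. 2 * exp (- 2 * e\<^sup>2) ^ Suc n" 0] simp del: power_Suc)
    from borel_cantelli_AE1[OF E _ this]
    have "AE \<omega> in M. \<forall>\<^sub>F n in sequentially. \<omega> \<in> space M - E n"
      by (simp add: emeasure_eq_measure)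
    then show ?thesis
      by eventually_elim (auto elim!: eventually_mono simp: E_def not_le)
  qed
  \<comment> \<open>Restricting the tolerance to the countable family
    \<open>inverse (real (Suc k))\<close> allows "almost surely" and "for every tolerance" to be
    exchanged.\<close>
  have "AE \<omega> in M. \<forall>k. \<forall>\<^sub>F n in sequentially.
      \<bar>(\<Sum>j=1..Suc n. \<xi> j \<omega>) / real (Suc n) - measure \<alpha> A\<bar> < inverse (real (Suc k))"
    unfolding AE_all_countable by (intro allI ev) simp
  then show ?thesis
  proof eventually_elim
    case (elim \<omega>)
    show ?case
    proof (rule tendstoI)
      fix e :: real assume "0 < e"
      then obtain k where "inverse (real (Suc k)) < e" using reals_Archimedean by blast
      with elim[rule_format, of k]
      show "\<forall>\<^sub>F n in sequentially.
          dist ((\<Sum>j=1..Suc n. indicator A (X j \<omega>)) / real (Suc n)) (measure \<alpha> A) < e"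
        by (auto elim!: eventually_mono simp: dist_real_def \<xi>_def)
    qed
  qed
qed

text \<open>Monotonicity squeezes the value at \<open>x\<close> between values at rational points on
  either side, and continuity of the limit at \<open>x\<close> closes the gap. Countably many points
  thus control all continuity points.\<close>

lemma tendsto_mono_of_rationals:
  fixes F :: "nat \<Rightarrow> real \<Rightarrow> real" and G :: "real \<Rightarrow> real"
  assumes mono: "\<And>n. mono (F n)" and lim: "\<And>q. q \<in> \<rat> \<Longrightarrow> (\<lambda>n. F n q) \<longlonglongrightarrow> G q" and cont: "isCont G x"
  shows "(\<lambda>n. F n x) \<longlonglongrightarrow> G x"
proof (rule tendstoI)
  fix e :: real assume e: "0 < e"
  then obtain \<delta> where \<delta>: "0 < \<delta>" "\<And>y. \<bar>y - x\<bar> < \<delta> \<Longrightarrow> \<bar>G y - G x\<bar> < e"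
    using cont unfolding continuous_at_eps_delta dist_real_def by blast
  obtain p where p: "p \<in> \<rat>" "x - \<delta> < p" "p < x" using Rats_dense_in_real[of "x - \<delta>" x] \<delta> by auto
  obtain q where q: "q \<in> \<rat>" "x < q" "q < x + \<delta>" using Rats_dense_in_real[of x "x + \<delta>"] \<delta> by auto
  have "G x - e < G p" "G q < G x + e"
    using \<delta>(2)[of p] \<delta>(2)[of q] p q by auto
  then have "\<forall>\<^sub>F n in sequentially. G x - e < F n p" "\<forall>\<^sub>F n in sequentially. F n q < G x + e"
    using order_tendstoD(1)[OF lim[OF p(1)]] order_tendstoD(2)[OF lim[OF q(1)]] by blast+
  then show "\<forall>\<^sub>F n in sequentially. dist (F n x) (G x) < e"
  proof eventually_elim
    case (elim n)
    have "F n p \<le> F n x" "F n x \<le> F n q" using mono[of n] p q by (auto simp: mono_def)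
    with elim show ?case by (simp add: dist_real_def abs_less_iff)
  qed
qed

lemma (in prob_space) empirical_measure_tendsto:
  fixes X :: "nat \<Rightarrow> 'a \<Rightarrow> 'c::metric_space"
  assumes cpt: "compact (UNIV :: 'c set)" and \<alpha>: "\<alpha> \<in> prob_measures UNIV dist"
    and indep: "indep_vars (\<lambda>_. borel) X {1..}" and distr: "\<And>j. 1 \<le> j \<Longrightarrow> distr M borel (X j) = \<alpha>"
  shows "AE \<omega> in M. (\<lambda>n. wasserstein2 dist (dirac_average borel n (\<lambda>j. X j \<omega>)) \<alpha>) \<longlonglongrightarrow> 0"
proof -
  obtain s :: "'c \<Rightarrow> real" and h K where s: "s \<in> borel_measurable borel" "\<And>x. 0 \<le> s x" "\<And>x. s x \<le> 1"
    and K: "closed K" "\<And>x. s x \<in> K" "continuous_on K h" "h \<in> borel_measurable borel" "\<And>x. h (s x) = x"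
    by (rule compact_coding_continuous_inverse[OF cpt]) blast
  have \<alpha>': "prob_space \<alpha>" "sets \<alpha> = sets borel" "space \<alpha> = UNIV"
    using \<alpha> by (auto simp: prob_measures_def metric_borel_UNIV_dist)
  have sm[measurable]: "s \<in> borel_measurable \<alpha>"
    using s(1) by (simp add: measurable_cong_sets[OF \<alpha>'(2) refl])
  have rd: "real_distribution (distr \<beta> borel s)" if "prob_space \<beta>" "sets \<beta> = sets borel" for \<beta>
  proof -
    interpret \<beta>: prob_space \<beta> by fact
    show ?thesis
      using s(1) by (intro \<beta>.real_distribution_distr) (simp add: measurable_cong_sets[OF that(2) refl])
  qed
  have A: "s -` {..q} \<in> sets borel" for q
    using measurable_sets[OF s(1), of "{..q}"] by simp
  \<comment> \<open>The frequency of codes at most \<open>q\<close> is the distribution function of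
    the coded empirical measure at \<open>q\<close>. Rational \<open>q\<close> keep the union of the
    exceptional sets null.\<close>
  have "AE \<omega> in M. \<forall>q\<in>\<rat>. (\<lambda>n. (\<Sum>j=1..Suc n. indicator (s -` {..q}) (X j \<omega>)) / real (Suc n))
      \<longlonglongrightarrow> measure \<alpha> (s -` {..q})"
    unfolding AE_ball_countable[OF countable_rat]
    by (intro ballI strong_law_indicator[OF indep distr A])
  then show ?thesis
  proof eventually_elim
    case (elim \<omega>)
    define \<mu> where "\<mu> n = dirac_average borel (Suc n) (\<lambda>j. X j \<omega>)" for n
    have \<mu>: "prob_space (\<mu> n)" "sets (\<mu> n) = sets borel" "space (\<mu> n) = UNIV" for n
      unfolding \<mu>_def by (auto intro!: prob_space_dirac_average)
    have cdf: "cdf (distr \<beta> borel s) q = measure \<beta> (s -` {..q})"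
      if "sets \<beta> = sets borel" "space \<beta> = UNIV" for \<beta> q
      using s(1) that by (subst cdf_def2, subst measure_distr) (auto simp: measurable_cong_sets[OF that(1) refl])
    have "(\<lambda>n. cdf (distr (\<mu> n) borel s) x) \<longlonglongrightarrow> cdf (distr \<alpha> borel s) x"
      if "isCont (cdf (distr \<alpha> borel s)) x" for x
    proof (rule tendsto_mono_of_rationals[OF _ _ that])
      fix n
      interpret D: real_distribution "distr (\<mu> n) borel s"
        using \<mu> by (intro rd)
      show "mono (cdf (distr (\<mu> n) borel s))"
        by (intro monoI D.cdf_nondecreasing)
    next
      fix q :: real assume "q \<in> \<rat>"
      then show "(\<lambda>n. cdf (distr (\<mu> n) borel s) q) \<longlonglongrightarrow> cdf (distr \<alpha> borel s) q"
        using elim by (simp add: cdf \<mu> \<alpha>' \<mu>_def measure_dirac_average A del: of_nat_Suc sum.cl_ivl_Suc)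
    qed
    then have weak: "weak_conv_m (\<lambda>n. distr (\<mu> n) borel s) (distr \<alpha> borel s)"
      by (simp add: weak_conv_m_def weak_conv_def)
    have "\<mu> n \<in> prob_measures UNIV dist" for n
      using \<mu> by (simp add: prob_measures_def metric_borel_UNIV_dist)
    note wasserstein2_tendsto_of_weak_conv(2)[OF cpt this s(1) K(4) K(1-3,5) rd[OF \<alpha>'(1,2)] weak]
    \<comment> \<open>Here the weak limit is itself a coded measure, so mapping it back gives
      \<open>\<alpha>\<close>.\<close>
    moreover have "distr (distr \<alpha> borel s) borel h = \<alpha>"
      using K sm \<alpha>' by (subst distr_distr) (auto simp: comp_def distr_id2)
    ultimately have "(\<lambda>n. wasserstein2 dist (\<mu> n) \<alpha>) \<longlonglongrightarrow> 0" by simp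
    then show ?case unfolding \<mu>_def by (rule LIMSEQ_imp_Suc)
  qed
qed

subsection \<open>Wasserstein distances of approximating spaces\<close>

text \<open>A nearly optimal coupling is pushed through \<open>j\<close> in both coordinates, and
  the constant \<open>e\<close> is absorbed by Minkowski's inequality. The set \<open>C\<close>
  carries both measures; it is there for maps that control distances only on part of the space, such
  as a retraction onto the sample.\<close>

lemma wasserstein2_map_le:
  assumes tb: "totally_bounded_metric_space Y \<rho>" and tb': "totally_bounded_metric_space Y' \<rho>'"
    and j[measurable]: "j \<in> metric_borel Y \<rho> \<rightarrow>\<^sub>M metric_borel Y' \<rho>'"
    and \<mu>\<nu>: "\<mu> \<in> prob_measures Y \<rho>" "\<nu> \<in> prob_measures Y \<rho>"
    and C: "C \<in> sets (metric_borel Y \<rho>)" "AE x in \<mu>. x \<in> C" "AE x in \<nu>. x \<in> C"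
    and le: "\<And>x y. x \<in> C \<Longrightarrow> y \<in> C \<Longrightarrow> \<rho>' (j x) (j y) \<le> \<rho> x y + e" and e: "0 < e"
  shows "wasserstein2 \<rho>' (distr \<mu> (metric_borel Y' \<rho>') j) (distr \<nu> (metric_borel Y' \<rho>') j)
    \<le> wasserstein2 \<rho> \<mu> \<nu> + e"
proof -
  interpret Y: totally_bounded_metric_space Y \<rho> by fact
  interpret Y': totally_bounded_metric_space Y' \<rho>' by fact
  note \<mu> = Y.prob_measuresD[OF \<mu>\<nu>(1)] and \<nu> = Y.prob_measuresD[OF \<mu>\<nu>(2)]
  have j\<mu>: "j \<in> \<mu> \<rightarrow>\<^sub>M Y'.B" and j\<nu>: "j \<in> \<nu> \<rightarrow>\<^sub>M Y'.B"
    using j by (simp_all add: measurable_cong_sets[OF \<mu>(3) refl] measurable_cong_sets[OF \<nu>(3) refl])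
  have P: "distr \<mu> Y'.B j \<in> Y'.\<P>" "distr \<nu> Y'.B j \<in> Y'.\<P>"
    using prob_space.prob_space_distr[OF \<mu>(1) j\<mu>] prob_space.prob_space_distr[OF \<nu>(1) j\<nu>]
    by (simp_all add: prob_measures_def)
  have *: "wasserstein2 \<rho>' (distr \<mu> Y'.B j) (distr \<nu> Y'.B j) \<le> A + e" if A: "wasserstein2 \<rho> \<mu> \<nu> < A" for A
  proof -
    obtain \<pi> where \<pi>: "\<pi> \<in> couplings \<mu> \<nu>"
      "(\<integral>\<^sup>+ z. ennreal ((\<rho> (fst z) (snd z))\<^sup>2) \<partial>\<pi>) \<le> ennreal (A\<^sup>2)"
      by (rule Y.wasserstein2_lessE[OF \<mu>\<nu> A])
    note c = Y.couplingsD[OF \<mu>\<nu> \<pi>(1)]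
    interpret \<pi>: prob_space \<pi> using c by simp
    have A0: "0 < A" using A wasserstein2_nonneg[of \<rho> \<mu> \<nu>] by linarith
    have m: "(\<lambda>z. j (fst z)) \<in> \<pi> \<rightarrow>\<^sub>M Y'.B" "(\<lambda>z. j (snd z)) \<in> \<pi> \<rightarrow>\<^sub>M Y'.B"
      using measurable_compose[OF c(8) j] measurable_compose[OF c(9) j] by simp_all
    have [measurable]: "(\<lambda>z. \<rho> (fst z) (snd z)) \<in> borel_measurable \<pi>"
      using Y.borel_measurable_metric by (simp add: measurable_cong_sets[OF c(1) refl])
    have id: "distr \<mu> Y.B id = \<mu>" "distr \<nu> Y.B id = \<nu>"
      using \<mu> \<nu> by (auto intro!: distr_id2 simp: id_def)
    have law1: "distr \<pi> Y'.B (\<lambda>z. j (fst z)) = distr \<mu> Y'.B j"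
      using distr_distr[OF j c(8)] by (simp add: c id comp_def)
    have law2: "distr \<pi> Y'.B (\<lambda>z. j (snd z)) = distr \<nu> Y'.B j"
      using distr_distr[OF j c(9)] by (simp add: c id comp_def)
    have C': "{x \<in> space Y.B. x \<in> C} \<in> sets Y.B"
      using C(1) sets.sets_into_space[OF C(1)] by (simp add: Collect_conj_eq Int_absorb1)
    have "AE x in distr \<pi> Y.B fst. x \<in> C" "AE x in distr \<pi> Y.B snd. x \<in> C"
      unfolding c(4,5) id by (fact C)+
    then have "AE z in \<pi>. fst z \<in> C" "AE z in \<pi>. snd z \<in> C"
      using AE_distr_iff[OF c(8) C'] AE_distr_iff[OF c(9) C'] by simp_all
    then have "AE z in \<pi>. 0 \<le> \<rho>' (j (fst z)) (j (snd z)) \<and> \<rho>' (j (fst z)) (j (snd z)) \<le> \<rho> (fst z) (snd z) + e"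
      by eventually_elim (use le in auto)
    moreover have "(\<integral>\<^sup>+ z. ennreal (e\<^sup>2) \<partial>\<pi>) \<le> ennreal (e\<^sup>2)"
      by (simp add: \<pi>.emeasure_space_1)
    ultimately have "(\<integral>\<^sup>+ z. ennreal ((\<rho>' (j (fst z)) (j (snd z)))\<^sup>2) \<partial>\<pi>) \<le> ennreal ((A + e)\<^sup>2)"
      using A0 e by (intro nn_integral_square_add[where g = "\<lambda>_. e", OF _ _ _ \<pi>(2)]) simp_all
    then show ?thesis
      using A0 e by (intro Y'.wasserstein2_le_distr[OF \<pi>.prob_space_axioms m P law1 law2]) auto
  qed
  have "wasserstein2 \<rho>' (distr \<mu> Y'.B j) (distr \<nu> Y'.B j) - e \<le> wasserstein2 \<rho> \<mu> \<nu>"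
  proof (rule dense_ge)
    fix A assume "wasserstein2 \<rho> \<mu> \<nu> < A"
    from *[OF this] show "wasserstein2 \<rho>' (distr \<mu> Y'.B j) (distr \<nu> Y'.B j) - e \<le> A"
      by linarith
  qed
  then show ?thesis by simp
qed

text \<open>A finite Hausdorff space is discrete. Whatever metric is estimated on the sample, every
  function defined on it is therefore measurable.\<close>

lemma sets_metric_borel_finite:
  assumes "Metric_space Y \<rho>" "finite Y"
  shows "sets (metric_borel Y \<rho>) = Pow Y"
proof -
  interpret Metric_space Y \<rho> by fact
  have "openin mtopology U" if "U \<subseteq> Y" for U
  proof -
    have "closedin mtopology (Y - U)"
      using Hausdorff_imp_t1_space[OF Hausdorff_space_mtopology] assms(2)
      unfolding t1_space_closedin_finite by auto
    then show ?thesis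
      using that by (simp add: closedin_def double_diff)
  qed
  then have "Pow Y \<subseteq> sets (metric_borel Y \<rho>)"
    unfolding sets_metric_borel[OF assms(1)] by (auto intro: sigma_sets.Basic)
  moreover have "sets (metric_borel Y \<rho>) \<subseteq> Pow Y"
    using sets.sets_into_space space_metric_borel[OF assms(1)] by blast
  ultimately show ?thesis by blast
qed

text \<open>One sample space at a fixed sample size and a fixed outcome. The same \<open>e\<close>
  bounds the distortion of the inclusion and the mesh of the sample as a net.\<close>

locale finite_metric_approximation =
  fixes Y :: "'a::metric_space set" and \<rho> :: "'a \<Rightarrow> 'a \<Rightarrow> real" and e :: real
  assumes compact: "compact (UNIV :: 'a set)"
    and metric: "Metric_space Y \<rho>" and finite: "finite Y" and nonempty: "Y \<noteq> {}"
    and close: "\<And>x y. x \<in> Y \<Longrightarrow> y \<in> Y \<Longrightarrow> \<bar>\<rho> x y - dist x y\<bar> < e"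
    and net: "\<And>y. \<exists>x\<in>Y. dist y x < e"
begin

text \<open>Points keep their type, so the inclusion is the identity function; what changes is the
  underlying space and the sigma-algebra, from all subsets of \<open>Y\<close> to the Borel sets of
  \<open>X\<close>.\<close>

definition embed :: "'a measure \<Rightarrow> 'a measure" where
  "embed \<nu> = distr \<nu> borel (\<lambda>x. x)"

sublocale Y: totally_bounded_metric_space Y \<rho>
  by (rule finite_totally_bounded_metric_space[OF metric finite])

sublocale X: totally_bounded_metric_space "UNIV :: 'a set" dist
  rewrites "metric_borel (UNIV :: 'a set) dist = borel"
  by (rule compact_totally_bounded_metric_space[OF compact]) (rule metric_borel_UNIV_dist)

lemma e_pos: "0 < e"
  using net[of undefined] by (meson le_less_trans zero_le_dist)

lemma inclusion_measurable: "(\<lambda>x. x) \<in> Y.B \<rightarrow>\<^sub>M borel"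
  by (rule measurableI) (auto simp: sets_metric_borel_finite[OF metric finite])

lemma embed_in: "\<nu> \<in> Y.\<P> \<Longrightarrow> embed \<nu> \<in> prob_measures UNIV dist"
proof -
  assume "\<nu> \<in> Y.\<P>"
  note \<nu> = Y.prob_measuresD[OF this]
  have "(\<lambda>x. x) \<in> \<nu> \<rightarrow>\<^sub>M borel"
    using inclusion_measurable by (simp add: measurable_cong_sets[OF \<nu>(3) refl])
  then show ?thesis
    using prob_space.prob_space_distr[OF \<nu>(1)] by (simp add: prob_measures_def embed_def metric_borel_UNIV_dist)
qed

lemma wasserstein2_embed_le:
  assumes "\<mu> \<in> Y.\<P>" "\<nu> \<in> Y.\<P>"
  shows "wasserstein2 dist (embed \<mu>) (embed \<nu>) \<le> wasserstein2 \<rho> \<mu> \<nu> + e"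
proof -
  have AE: "AE x in \<beta>. x \<in> Y" if "\<beta> \<in> Y.\<P>" for \<beta>
    using Y.prob_measuresD(2)[OF that] by (intro AE_I2) simp
  have "dist x y \<le> \<rho> x y + e" if "x \<in> Y" "y \<in> Y" for x y
    using close[OF that] by linarith
  from wasserstein2_map_le[OF Y.totally_bounded_metric_space_axioms X.totally_bounded_metric_space_axioms
      _ assms _ AE[OF assms(1)] AE[OF assms(2)] this e_pos]
  show ?thesis
    using inclusion_measurable sets.top[of Y.B] by (simp add: metric_borel_UNIV_dist embed_def)
qed

text \<open>To return from \<open>X\<close> to \<open>Y\<close> the inclusion is inverted by a Borel
  retraction. It is far from isometric off \<open>Y\<close>, but embedded measures are concentrated
  on \<open>Y\<close>.\<close>

lemma wasserstein2_le_embed: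
  assumes "\<mu> \<in> Y.\<P>" "\<nu> \<in> Y.\<P>"
  shows "wasserstein2 \<rho> \<mu> \<nu> \<le> wasserstein2 dist (embed \<mu>) (embed \<nu>) + e"
proof -
  obtain y0 where y0: "y0 \<in> Y" using nonempty by blast
  define r where "r x = (if x \<in> Y then x else y0)" for x
  have r: "r \<in> borel \<rightarrow>\<^sub>M Y.B"
  proof (rule measurableI)
    fix A assume "A \<in> sets Y.B"
    then have A: "A \<subseteq> Y" by (simp add: sets_metric_borel_finite[OF metric finite])
    then have "r -` A \<inter> space borel = A \<union> (if y0 \<in> A then - Y else {})"
      by (auto simp: r_def split: if_splits)
    moreover have "closed A" "closed Y"
      using finite A finite_subset by (auto intro: finite_imp_closed)
    ultimately show "r -` A \<inter> space borel \<in> sets borel" by simp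
  qed (use y0 in \<open>auto simp: r_def\<close>)
  have Y: "closed Y" using finite by (rule finite_imp_closed)
  have AE: "AE x in embed \<beta>. x \<in> Y" and distr_r: "distr (embed \<beta>) Y.B r = \<beta>" if "\<beta> \<in> Y.\<P>" for \<beta>
  proof -
    note \<beta> = Y.prob_measuresD[OF that]
    have i: "(\<lambda>x. x) \<in> \<beta> \<rightarrow>\<^sub>M borel"
      using inclusion_measurable by (simp add: measurable_cong_sets[OF \<beta>(3) refl])
    show "AE x in embed \<beta>. x \<in> Y"
      unfolding embed_def using Y \<beta>(2) by (subst AE_distr_iff[OF i]) (auto intro: AE_I2)
    have "distr (embed \<beta>) Y.B r = distr \<beta> Y.B r"
      unfolding embed_def using distr_distr[OF r i] by (simp add: comp_def)
    also have "\<dots> = distr \<beta> Y.B (\<lambda>x. x)"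
      using \<beta>(2) by (intro distr_cong) (auto simp: r_def)
    finally show "distr (embed \<beta>) Y.B r = \<beta>"
      using \<beta>(3) by (simp add: distr_id2)
  qed
  have "\<rho> (r x) (r y) \<le> dist x y + e" if "x \<in> Y" "y \<in> Y" for x y
    using close[OF that] that by (simp add: r_def)
  from wasserstein2_map_le[OF X.totally_bounded_metric_space_axioms Y.totally_bounded_metric_space_axioms
      _ embed_in[OF assms(1)] embed_in[OF assms(2)] _ AE[OF assms(1)] AE[OF assms(2)] this e_pos]
  show ?thesis
    using r Y by (simp add: metric_borel_UNIV_dist distr_r assms)
qed

text \<open>Quantisation: moving each point to a nearby sample point couples \<open>\<beta>\<close>
  with an embedded measure, and no point travels as far as \<open>e\<close>.\<close>

lemma embed_dense:
  assumes \<beta>: "\<beta> \<in> prob_measures UNIV dist"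
  shows "\<exists>\<nu>\<in>Y.\<P>. wasserstein2 dist \<beta> (embed \<nu>) \<le> e"
proof -
  note \<beta>' = X.prob_measuresD[OF \<beta>]
  obtain T where T: "T \<in> metric_borel UNIV dist \<rightarrow>\<^sub>M count_space Y" "\<And>x. dist x (T x) < e"
  proof (rule measurable_near_point_map[OF Met_TC.Metric_space_axioms finite subset_UNIV net])
    fix T assume "T \<in> metric_borel UNIV dist \<rightarrow>\<^sub>M count_space Y" "\<And>x. x \<in> UNIV \<Longrightarrow> dist x (T x) < e"
    then show thesis by (intro that) auto
  qed
  have T': "T \<in> \<beta> \<rightarrow>\<^sub>M Y.B"
    using T(1) by (simp add: metric_borel_UNIV_dist \<beta>'(2,3) measurable_def sets_metric_borel_finite[OF metric finite])
  have dT: "distr \<beta> Y.B T \<in> Y.\<P>"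
    using prob_space.prob_space_distr[OF \<beta>'(1) T'] by (simp add: prob_measures_def)
  have T'': "T \<in> \<beta> \<rightarrow>\<^sub>M borel"
    using measurable_compose[OF T' inclusion_measurable] .
  have law: "distr \<beta> borel T = embed (distr \<beta> Y.B T)"
    unfolding embed_def using distr_distr[OF inclusion_measurable T'] by (simp add: comp_def)
  interpret \<beta>: prob_space \<beta> by fact
  have "(\<integral>\<^sup>+ x. ennreal ((dist x (T x))\<^sup>2) \<partial>\<beta>) \<le> (\<integral>\<^sup>+ x. ennreal (e\<^sup>2) \<partial>\<beta>)"
    using T(2) by (intro nn_integral_mono ennreal_leI power_mono) (auto intro: less_imp_le)
  then have "wasserstein2 dist \<beta> (embed (distr \<beta> Y.B T)) \<le> e"
    using e_pos \<beta>'(3) T''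
    by (intro X.wasserstein2_le_distr[OF \<beta>'(1) _ _ \<beta> embed_in[OF dT] _ law[symmetric, THEN sym]])
      (auto simp: \<beta>.emeasure_space_1 distr_id2 measurable_ident_sets)
  then show ?thesis using dT by blast
qed

end

subsection \<open>Convergence of minimizers\<close>

lemma tendsto_Min_image:
  fixes f :: "'i \<Rightarrow> 'c \<Rightarrow> real"
  assumes "finite J" "J \<noteq> {}" "\<And>j. j \<in> J \<Longrightarrow> ((\<lambda>n. f j n) \<longlongrightarrow> l j) F"
  shows "((\<lambda>n. Min ((\<lambda>j. f j n) ` J)) \<longlongrightarrow> Min (l ` J)) F"
  using assms
proof (induction J rule: finite_ne_induct)
  case (insert j J)
  then show ?case
    by (auto intro!: tendsto_min simp: Min_insert)
qed auto

text \<open>Matching members of equal index bounds both one-sided distances at once, even when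
  \<open>f\<close> or \<open>g\<close> repeats values.\<close>

lemma hausdorff_distance_image_le:
  fixes \<rho> :: "'b \<Rightarrow> 'b \<Rightarrow> real"
  assumes J: "finite J" "J \<noteq> {}" and nonneg: "\<And>x y. 0 \<le> \<rho> x y" and sym: "\<And>x y. \<rho> x y = \<rho> y x"
    and le: "\<And>j. j \<in> J \<Longrightarrow> \<rho> (f j) (g j) \<le> \<epsilon>"
  shows "hausdorff_distance \<rho> (f ` J) (g ` J) \<le> \<epsilon>"
proof -
  have bdd: "bdd_below (\<rho> a ` B)" for a B
    using nonneg by (intro bdd_belowI2[of _ 0]) auto
  have "(SUP a\<in>f ` J. INF b\<in>g ` J. \<rho> a b) \<le> \<epsilon>"
  proof (rule cSUP_least)
    fix a assume "a \<in> f ` J"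
    then obtain j where j: "j \<in> J" "a = f j" by blast
    then show "(INF b\<in>g ` J. \<rho> a b) \<le> \<epsilon>"
      using le[of j] by (intro cINF_lower2[OF bdd, of "g j"]) auto
  qed (use J in auto)
  moreover have "(SUP b\<in>g ` J. INF a\<in>f ` J. \<rho> b a) \<le> \<epsilon>"
  proof (rule cSUP_least)
    fix b assume "b \<in> g ` J"
    then obtain j where j: "j \<in> J" "b = g j" by blast
    then show "(INF a\<in>f ` J. \<rho> b a) \<le> \<epsilon>"
      using le[of j] sym[of "f j" "g j"] by (intro cINF_lower2[OF bdd, of "f j"]) auto
  qed (use J in auto)
  ultimately show ?thesis by (simp add: hausdorff_distance_def)
qed

text \<open>Sets of different cardinality are listed with repetitions as families of the same length
  \<open>k\<close>, so that a sequence of sets becomes \<open>k\<close> sequences of points.\<close>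

lemma finite_subsets_upto_image_lessThan:
  assumes "S \<in> finite_subsets_upto Y k"
  obtains f :: "nat \<Rightarrow> 'b" where "f ` {..<k} = S"
proof -
  have S: "finite S" "S \<noteq> {}" "card S \<le> k"
    using assms by (auto simp: finite_subsets_upto_def)
  obtain h where h: "bij_betw h {0..<card S} S"
    using ex_bij_betw_nat_finite[OF S(1)] by blast
  have pos: "0 < card S" using S by (simp add: card_gt_0_iff)
  \<comment> \<open>Surplus indices repeat the member \<open>h 0\<close>, which exists because
    \<open>S\<close> is nonempty.\<close>
  define f where "f i = h (if i < card S then i else 0)" for i
  have "f ` {..<k} = h ` {0..<card S}"
  proof
    show "f ` {..<k} \<subseteq> h ` {0..<card S}" using pos by (auto simp: f_def)
    show "h ` {0..<card S} \<subseteq> f ` {..<k}"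
    proof
      fix y assume "y \<in> h ` {0..<card S}"
      then obtain i where "i < card S" "y = h i" by auto
      then show "y \<in> f ` {..<k}" using S(3) by (auto simp: f_def intro!: image_eqI[of _ _ i])
    qed
  qed
  then show thesis using that h by (simp add: bij_betw_def)
qed

lemma image_lessThan_in_finite_subsets_upto:
  fixes f :: "nat \<Rightarrow> 'b"
  assumes "1 \<le> k" "\<And>j. j < k \<Longrightarrow> f j \<in> Y"
  shows "f ` {..<k} \<in> finite_subsets_upto Y k"
  using assms card_image_le[of "{..<k}" f] by (auto simp: finite_subsets_upto_def lessThan_empty_iff)

text \<open>Each further coordinate refines the subsequence found so far, and the earlier limits
  survive the refinement.\<close>

lemma simultaneous_subsequence:
  fixes W :: "'b \<Rightarrow> 'b \<Rightarrow> real" and t :: "nat \<Rightarrow> nat \<Rightarrow> 'b" and k :: nat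
  assumes seq_compact: "\<And>u :: nat \<Rightarrow> 'b. (\<And>n. u n \<in> P) \<Longrightarrow>
      \<exists>r x. strict_mono (r :: nat \<Rightarrow> nat) \<and> x \<in> P \<and> (\<lambda>n. W (u (r n)) x) \<longlonglongrightarrow> 0"
    and t: "\<And>n j. j < k \<Longrightarrow> t n j \<in> P"
  shows "\<exists>r x. strict_mono (r :: nat \<Rightarrow> nat) \<and> (\<forall>j<k. x j \<in> P \<and> (\<lambda>n. W (t (r n) j) (x j)) \<longlonglongrightarrow> 0)"
  using t
proof (induction k)
  case 0
  show ?case using strict_mono_id by (intro exI[of _ id]) auto
next
  case (Suc k)
  obtain r x where r: "strict_mono (r :: nat \<Rightarrow> nat)"
    and x: "\<And>j. j < k \<Longrightarrow> x j \<in> P \<and> (\<lambda>n. W (t (r n) j) (x j)) \<longlonglongrightarrow> 0"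
    using Suc by (metis less_SucI)
  obtain q y where q: "strict_mono (q :: nat \<Rightarrow> nat)" and y: "y \<in> P" "(\<lambda>n. W (t (r (q n)) k) y) \<longlonglongrightarrow> 0"
    using seq_compact[of "\<lambda>n. t (r n) k"] Suc.prems by blast
  have "(x(k := y)) j \<in> P \<and> (\<lambda>n. W (t ((r \<circ> q) n) j) ((x(k := y)) j)) \<longlonglongrightarrow> 0" if "j < Suc k" for j
  proof (cases "j = k")
    case False
    then have "j < k" using that by simp
    with x[OF this] show ?thesis
      using LIMSEQ_subseq_LIMSEQ[OF conjunct2[OF x[OF \<open>j < k\<close>]] q] False by (simp add: comp_def)
  qed (use y in simp)
  then show ?case
    using strict_mono_o[OF r q] by blast
qed

section \<open>Stability of sets of \<open>k\<close>-means under approximation of metric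
  spaces\<close>

text \<open>The \<open>k\<close>-means cost for an average of point masses as a real number, so that
  limits and comparisons take place in the reals.\<close>

definition average_cost :: "('b \<Rightarrow> 'b \<Rightarrow> real) \<Rightarrow> nat \<Rightarrow> (nat \<Rightarrow> 'b) \<Rightarrow> real \<Rightarrow> 'b set \<Rightarrow> real" where
  "average_cost W m \<alpha> p S = (\<Sum>i=1..m. Min ((\<lambda>x. W (\<alpha> i) x powr p) ` S)) / real m"

definition average_cost_minimizers ::
    "'b set \<Rightarrow> ('b \<Rightarrow> 'b \<Rightarrow> real) \<Rightarrow> nat \<Rightarrow> (nat \<Rightarrow> 'b) \<Rightarrow> real \<Rightarrow> nat \<Rightarrow> 'b set set" where
  "average_cost_minimizers P W m \<alpha> p k =
     {S \<in> finite_subsets_upto P k.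
        \<forall>T \<in> finite_subsets_upto P k. average_cost W m \<alpha> p S \<le> average_cost W m \<alpha> p T}"

text \<open>\<open>P\<close> stands for the measures on \<open>X\<close>, \<open>Q n\<close> for
  those on the sample and \<open>\<iota> n\<close> for push-forward along the inclusion. Properties
  of \<open>Q n\<close> are required from \<open>n = 1\<close> on, since the sample of size 0 is
  empty.\<close>

locale metric_approximation = Metric_space P W
  for P :: "'b set" and W :: "'b \<Rightarrow> 'b \<Rightarrow> real" +
  fixes Q :: "nat \<Rightarrow> 'c set" and V :: "nat \<Rightarrow> 'c \<Rightarrow> 'c \<Rightarrow> real" and \<iota> :: "nat \<Rightarrow> 'c \<Rightarrow> 'b"
    and e :: "nat \<Rightarrow> real"
  assumes seq_compact: "\<And>u :: nat \<Rightarrow> 'b. (\<And>n. u n \<in> P) \<Longrightarrow>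
      \<exists>r x. strict_mono (r :: nat \<Rightarrow> nat) \<and> x \<in> P \<and> (\<lambda>n. W (u (r n)) x) \<longlonglongrightarrow> 0"
    and V_nonneg: "\<And>n x y. 0 \<le> V n x y"
    and \<iota>: "\<And>n x. 1 \<le> n \<Longrightarrow> x \<in> Q n \<Longrightarrow> \<iota> n x \<in> P"
    and near_isometry: "\<And>n x y. 1 \<le> n \<Longrightarrow> x \<in> Q n \<Longrightarrow> y \<in> Q n \<Longrightarrow> \<bar>V n x y - W (\<iota> n x) (\<iota> n y)\<bar> \<le> e n"
    and dense: "\<And>n x. 1 \<le> n \<Longrightarrow> x \<in> P \<Longrightarrow> \<exists>y\<in>Q n. W x (\<iota> n y) \<le> e n"
    and e_0: "e \<longlonglongrightarrow> 0"
begin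

text \<open>The indices \<open>r\<close> only tend to infinity and need not increase, which fits
  indices picked as counterexamples. Each distance converges, and powers, minima over the fixed
  finite \<open>J\<close> and finite sums preserve convergence.\<close>

lemma average_cost_tendsto:
  assumes r: "filterlim r at_top sequentially" "\<And>N. 1 \<le> r N" and p: "0 < p" and m: "1 \<le> m"
    and \<alpha>: "\<And>i. i \<in> {1..m} \<Longrightarrow> \<alpha> i \<in> P" and a: "\<And>n i. 1 \<le> n \<Longrightarrow> i \<in> {1..m} \<Longrightarrow> a n i \<in> Q n"
    and lim_a: "\<And>i. i \<in> {1..m} \<Longrightarrow> (\<lambda>n. W (\<iota> n (a n i)) (\<alpha> i)) \<longlonglongrightarrow> 0"
    and J: "finite J" "J \<noteq> {}" and x: "\<And>j. j \<in> J \<Longrightarrow> x j \<in> P"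
    and u: "\<And>N j. j \<in> J \<Longrightarrow> u N j \<in> Q (r N)"
    and lim_u: "\<And>j. j \<in> J \<Longrightarrow> (\<lambda>N. W (\<iota> (r N) (u N j)) (x j)) \<longlonglongrightarrow> 0"
  shows "(\<lambda>N. average_cost (V (r N)) m (a (r N)) p (u N ` J)) \<longlonglongrightarrow> average_cost W m \<alpha> p (x ` J)"
proof -
  have "(\<lambda>N. V (r N) (a (r N) i) (u N j)) \<longlonglongrightarrow> W (\<alpha> i) (x j)" if i: "i \<in> {1..m}" and j: "j \<in> J" for i j
  proof (rule LIM_zero_cancel, rule Lim_null_comparison)
    \<comment> \<open>Three errors: the distortion of \<open>\<iota>\<close> and the displacement of
      each of the two points from its limit.\<close>
    let ?b = "\<lambda>N. e (r N) + W (\<iota> (r N) (a (r N) i)) (\<alpha> i) + W (\<iota> (r N) (u N j)) (x j)"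
    have "(\<lambda>N. e (r N)) \<longlonglongrightarrow> 0" "(\<lambda>N. W (\<iota> (r N) (a (r N) i)) (\<alpha> i)) \<longlonglongrightarrow> 0"
      using filterlim_compose[OF e_0 r(1)] filterlim_compose[OF lim_a[OF i] r(1)] by simp_all
    then show "?b \<longlonglongrightarrow> 0"
      using tendsto_add[OF tendsto_add lim_u[OF j]] by fastforce
    have "\<bar>V (r N) (a (r N) i) (u N j) - W (\<alpha> i) (x j)\<bar> \<le> ?b N" for N
    proof -
      note in_P = \<iota>[OF r(2) a[OF r(2) i]] \<iota>[OF r(2) u[OF j]] \<alpha>[OF i] x[OF j]
      have "\<bar>V (r N) (a (r N) i) (u N j) - W (\<iota> (r N) (a (r N) i)) (\<iota> (r N) (u N j))\<bar> \<le> e (r N)"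
        by (rule near_isometry[OF r(2) a[OF r(2) i] u[OF j]])
      moreover have "W (\<iota> (r N) (a (r N) i)) (\<iota> (r N) (u N j)) \<le>
          W (\<iota> (r N) (a (r N) i)) (\<alpha> i) + W (\<alpha> i) (x j) + W (\<iota> (r N) (u N j)) (x j)"
        using triangle[of "\<iota> (r N) (a (r N) i)" "\<alpha> i" "\<iota> (r N) (u N j)"]
          triangle[of "\<alpha> i" "x j" "\<iota> (r N) (u N j)"] in_P commute[of "x j"] by simp
      moreover have "W (\<alpha> i) (x j) \<le> W (\<iota> (r N) (a (r N) i)) (\<alpha> i) +
          W (\<iota> (r N) (a (r N) i)) (\<iota> (r N) (u N j)) + W (\<iota> (r N) (u N j)) (x j)"
        using triangle[of "\<alpha> i" "\<iota> (r N) (a (r N) i)" "x j"]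
          triangle[of "\<iota> (r N) (a (r N) i)" "\<iota> (r N) (u N j)" "x j"] in_P commute[of "\<alpha> i"] by simp
      ultimately show ?thesis by linarith
    qed
    then show "\<forall>\<^sub>F N in sequentially. norm (V (r N) (a (r N) i) (u N j) - W (\<alpha> i) (x j)) \<le> ?b N"
      by simp
  qed
  \<comment> \<open>A limiting distance may be 0, where \<open>powr\<close> on nonnegative bases is
    continuous because \<open>p\<close> is positive.\<close>
  then have "(\<lambda>N. V (r N) (a (r N) i) (u N j) powr p) \<longlonglongrightarrow> W (\<alpha> i) (x j) powr p"
    if "i \<in> {1..m}" "j \<in> J" for i j
    using that p by (intro tendsto_powr') (auto simp: V_nonneg)
  then show ?thesis
    unfolding average_cost_def image_image
    by (intro tendsto_divide tendsto_sum tendsto_Min_image J tendsto_const) (use m in auto)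
qed

lemma average_cost_minimizers_converge:
  assumes k: "1 \<le> k" and p: "0 < p" and m: "1 \<le> m"
    and \<alpha>: "\<And>i. i \<in> {1..m} \<Longrightarrow> \<alpha> i \<in> P" and a: "\<And>n i. 1 \<le> n \<Longrightarrow> i \<in> {1..m} \<Longrightarrow> a n i \<in> Q n"
    and lim_a: "\<And>i. i \<in> {1..m} \<Longrightarrow> (\<lambda>n. W (\<iota> n (a n i)) (\<alpha> i)) \<longlonglongrightarrow> 0"
    and \<epsilon>: "0 < \<epsilon>"
  shows "\<exists>N\<ge>1. \<forall>n\<ge>N. \<forall>S\<in>average_cost_minimizers (Q n) (V n) m (a n) p k.
    \<exists>S'\<in>average_cost_minimizers P W m \<alpha> p k. hausdorff_distance W (\<iota> n ` S) S' \<le> \<epsilon>"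
proof (rule ccontr)
  let ?min = "\<lambda>n. average_cost_minimizers (Q n) (V n) m (a n) p k"
  define bad where "bad n S \<longleftrightarrow> S \<in> ?min n \<and> (\<forall>S'\<in>average_cost_minimizers P W m \<alpha> p k. \<not> hausdorff_distance W (\<iota> n ` S) S' \<le> \<epsilon>)" for n S
  assume "\<not> ?thesis"
  \<comment> \<open>Negating the claim at \<open>Suc N\<close> keeps all bad indices at least 1,
    away from the empty sample.\<close>
  then have *: "\<not> (\<forall>n\<ge>Suc N. \<forall>S\<in>?min n. \<exists>S'\<in>average_cost_minimizers P W m \<alpha> p k.
      hausdorff_distance W (\<iota> n ` S) S' \<le> \<epsilon>)" for N
    by auto
  have "\<exists>n S. Suc N \<le> n \<and> bad n S" for N
    unfolding bad_def using *[of N] by blast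
  then obtain r S where r: "\<And>N. Suc N \<le> r N" and bad': "\<And>N. bad (r N) (S N)"
    by metis
  note bad = bad'[unfolded bad_def]
  have r1: "1 \<le> r N" for N using r[of N] by simp
  have "N \<le> r N" for N using r[of N] by simp
  then have r_lim: "filterlim r at_top sequentially"
    by (intro filterlim_at_top_mono[OF filterlim_ident] always_eventually allI)
  have S: "S N \<in> finite_subsets_upto (Q (r N)) k" for N
    using bad[of N] by (simp add: average_cost_minimizers_def)
  then have "\<exists>f :: nat \<Rightarrow> 'c. f ` {..<k} = S N" for N
    by (rule finite_subsets_upto_image_lessThan) blast
  then obtain t :: "nat \<Rightarrow> nat \<Rightarrow> 'c" where t: "\<And>N. t N ` {..<k} = S N"
    by metis
  have tQ: "t N j \<in> Q (r N)" if "j < k" for N j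
    using S[of N] t[of N] that by (auto simp: finite_subsets_upto_def)
  obtain q x where q: "strict_mono (q :: nat \<Rightarrow> nat)"
    and x: "\<And>j. j < k \<Longrightarrow> x j \<in> P" "\<And>j. j < k \<Longrightarrow> (\<lambda>N. W (\<iota> (r (q N)) (t (q N) j)) (x j)) \<longlonglongrightarrow> 0"
    using simultaneous_subsequence[of P W k "\<lambda>N j. \<iota> (r N) (t N j)", OF seq_compact \<iota>[OF r1 tQ]] by blast
  have rq: "filterlim (\<lambda>N. r (q N)) at_top sequentially"
    using filterlim_compose[OF r_lim filterlim_subseq[OF q]] .
  have J: "finite {..<k}" "{..<k} \<noteq> {}" using k by (auto simp: lessThan_empty_iff)
  have lim_S: "(\<lambda>N. average_cost (V (r (q N))) m (a (r (q N))) p (t (q N) ` {..<k})) \<longlonglongrightarrow> average_cost W m \<alpha> p (x ` {..<k})"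
    by (rule average_cost_tendsto[OF rq r1 p m \<alpha> a lim_a J]) (use x tQ in auto)
  have "average_cost W m \<alpha> p (x ` {..<k}) \<le> average_cost W m \<alpha> p T" if T: "T \<in> finite_subsets_upto P k" for T
  proof -
    have T': "T \<subseteq> P" "T \<noteq> {}" "finite T" "card T \<le> k"
      using T by (auto simp: finite_subsets_upto_def)
    \<comment> \<open>An arbitrary competitor \<open>T\<close> in the limit space is shadowed by
      competitors in the approximating spaces, against which the given minimizers are
      optimal.\<close>
    have "\<exists>h. \<forall>y\<in>T. h y \<in> Q (r (q N)) \<and> W y (\<iota> (r (q N)) (h y)) \<le> e (r (q N))" for N
      using dense[OF r1] T'(1) by (intro bchoice) blast
    then obtain h where h: "\<And>N y. y \<in> T \<Longrightarrow> h N y \<in> Q (r (q N))"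
      "\<And>N y. y \<in> T \<Longrightarrow> W y (\<iota> (r (q N)) (h N y)) \<le> e (r (q N))"
      by metis
    have "(\<lambda>N. W (\<iota> (r (q N)) (h N y)) y) \<longlonglongrightarrow> 0" if "y \<in> T" for y
    proof (rule Lim_null_comparison)
      show "(\<lambda>N. e (r (q N))) \<longlonglongrightarrow> 0" by (rule filterlim_compose[OF e_0 rq])
      show "\<forall>\<^sub>F N in sequentially. norm (W (\<iota> (r (q N)) (h N y)) y) \<le> e (r (q N))"
        using h(2)[OF that] by (simp add: commute[of _ y])
    qed
    then have lim_T: "(\<lambda>N. average_cost (V (r (q N))) m (a (r (q N))) p (h N ` T)) \<longlonglongrightarrow> average_cost W m \<alpha> p ((\<lambda>y. y) ` T)"
      by (intro average_cost_tendsto[OF rq r1 p m \<alpha> a lim_a T'(3,2)]) (use h T' in auto)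
    have "average_cost (V (r (q N))) m (a (r (q N))) p (t (q N) ` {..<k})
        \<le> average_cost (V (r (q N))) m (a (r (q N))) p (h N ` T)" for N
    proof -
      \<comment> \<open>Distinct points of \<open>T\<close> may be approximated by the same point;
        this only lowers the cardinality, so the competitor stays admissible.\<close>
      have "h N ` T \<in> finite_subsets_upto (Q (r (q N))) k"
        using h(1) T' card_image_le[OF T'(3), of "h N"] by (auto simp: finite_subsets_upto_def)
      then show ?thesis
        using bad[of "q N"] by (simp add: t average_cost_minimizers_def)
    qed
    then show ?thesis
      using LIMSEQ_le[OF lim_S lim_T] by auto
  qed
  then have min: "x ` {..<k} \<in> average_cost_minimizers P W m \<alpha> p k"
    using image_lessThan_in_finite_subsets_upto[OF k x(1)] by (simp add: average_cost_minimizers_def)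
  have "\<forall>\<^sub>F N in sequentially. \<forall>j\<in>{..<k}. W (\<iota> (r (q N)) (t (q N) j)) (x j) < \<epsilon>"
    using x(2) \<epsilon> by (intro eventually_ball_finite ballI order_tendstoD) auto
  then obtain N where N: "\<And>j. j < k \<Longrightarrow> W (\<iota> (r (q N)) (t (q N) j)) (x j) < \<epsilon>"
    by (auto simp: eventually_sequentially)
  \<comment> \<open>One index at which all \<open>k\<close> members are close to their limits
    already contradicts badness.\<close>
  have "hausdorff_distance W ((\<lambda>j. \<iota> (r (q N)) (t (q N) j)) ` {..<k}) (x ` {..<k}) \<le> \<epsilon>"
    using N by (intro hausdorff_distance_image_le J nonneg commute) (auto intro: less_imp_le)
  then have "hausdorff_distance W (\<iota> (r (q N)) ` S (q N)) (x ` {..<k}) \<le> \<epsilon>"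
    by (simp add: image_image flip: t)
  then show False using bad[of "q N"] min by blast
qed

end

section \<open>Barycenter sets of the sample spaces\<close>

lemma (in totally_bounded_metric_space) wasserstein_barycenter_sets_eq:
  assumes "1 \<le> m" and \<alpha>: "\<And>i. i \<in> {1..m} \<Longrightarrow> \<alpha> i \<in> \<P>"
  shows "wasserstein_barycenter_sets Y \<rho> m \<alpha> p k = average_cost_minimizers \<P> W m \<alpha> p k"
proof -
  have nn: "0 \<le> average_cost W m \<alpha> p S" if "S \<in> finite_subsets_upto \<P> k" for S
    unfolding average_cost_def using that
    by (intro divide_nonneg_nonneg sum_nonneg Min.boundedI) (auto simp: finite_subsets_upto_def)
  have "kmeans_cost W (dirac_average (metric_borel \<P> W) m \<alpha>) p S = ennreal (average_cost W m \<alpha> p S)"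
    if "S \<in> finite_subsets_upto \<P> k" for S
    unfolding average_cost_def using assms(1) \<alpha> that by (rule kmeans_cost_wasserstein2)
  then show ?thesis
    unfolding wasserstein_barycenter_sets_def kmeans_sets_def average_cost_minimizers_def
    using nn by (auto simp: ennreal_le_iff)
qed

theorem theorem3p14:
  fixes M :: "'w measure"
    and \<alpha> :: "nat \<Rightarrow> 'a::metric_space measure"
    and X :: "nat \<Rightarrow> nat \<Rightarrow> 'w \<Rightarrow> 'a"
    and d :: "nat \<Rightarrow> 'w \<Rightarrow> 'a \<Rightarrow> 'a \<Rightarrow> real"
    and m k :: nat and p :: real
  assumes "compact (UNIV :: 'a set)"
    and "1 \<le> k" and "k \<le> m" and "1 \<le> p"
    and "\<And>i. i \<in> {1..m} \<Longrightarrow> \<alpha> i \<in> prob_measures UNIV dist"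
    and "prob_space M"
    and "\<And>i. i \<in> {1..m} \<Longrightarrow> prob_space.indep_vars M (\<lambda>_. borel) (X i) {1..}"
    and "\<And>i j. i \<in> {1..m} \<Longrightarrow> 1 \<le> j \<Longrightarrow> distr M borel (X i j) = \<alpha> i"
    and "\<And>n \<omega>. 1 \<le> n \<Longrightarrow> \<omega> \<in> space M \<Longrightarrow> Metric_space (sample_set m X n \<omega>) (d n \<omega>)"
    and "AE \<omega> in M. GH_converges_by_inclusion (\<lambda>n. sample_set m X n \<omega>) (\<lambda>n. d n \<omega>)"
  shows "AE \<omega> in M. \<forall>\<epsilon>>0. \<exists>N. \<forall>n\<ge>N.
    \<forall>S\<^sub>n \<in> wasserstein_barycenter_sets (sample_set m X n \<omega>) (d n \<omega>) m
            (\<lambda>i. dirac_average (metric_borel (sample_set m X n \<omega>) (d n \<omega>)) n (\<lambda>j. X i j \<omega>)) p k.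
    \<exists>S \<in> wasserstein_barycenter_sets UNIV dist m \<alpha> p k.
      hausdorff_distance (wasserstein2 dist) ((\<lambda>\<nu>. distr \<nu> borel (\<lambda>x. x)) ` S\<^sub>n) S \<le> \<epsilon>"
proof -
  interpret M: prob_space M by fact
  interpret X: totally_bounded_metric_space "UNIV :: 'a set" dist
    by (rule compact_totally_bounded_metric_space) fact
  have m: "1 \<le> m" and p0: "0 < p" using assms(2-4) by simp_all
  \<comment> \<open>Finitely many null sets, one for each of the \<open>m\<close> measures; together
    with the Gromov-Hausdorff event they fix all randomness.\<close>
  have "AE \<omega> in M. \<forall>i\<in>{1..m}. (\<lambda>n. wasserstein2 dist (dirac_average borel n (\<lambda>j. X i j \<omega>)) (\<alpha> i)) \<longlonglongrightarrow> 0"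
    by (intro AE_finite_allI M.empirical_measure_tendsto assms) auto
  then show ?thesis
    using assms(10) AE_space
  proof eventually_elim
    case (elim \<omega>)
    define Y where "Y n = sample_set m X n \<omega>" for n
    define \<rho> where "\<rho> n = d n \<omega>" for n
    define a where "a n i = dirac_average (metric_borel (Y n) (\<rho> n)) n (\<lambda>j. X i j \<omega>)" for n i
    obtain e where e: "e \<longlonglongrightarrow> 0"
      "\<And>n x x'. 1 \<le> n \<Longrightarrow> x \<in> Y n \<Longrightarrow> x' \<in> Y n \<Longrightarrow> \<bar>\<rho> n x x' - dist x x'\<bar> < e n"
      "\<And>n y. 1 \<le> n \<Longrightarrow> Min ((\<lambda>x. dist y x) ` Y n) < e n"
      using elim(2) unfolding GH_converges_by_inclusion_def Y_def \<rho>_def by blast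
    have approx: "finite_metric_approximation (Y n) (\<rho> n) (e n)" if n: "1 \<le> n" for n
    proof (rule finite_metric_approximation.intro)
      show "compact (UNIV :: 'a set)" by fact
      show "Metric_space (Y n) (\<rho> n)"
        unfolding Y_def \<rho>_def using assms(9) n elim(3) by simp
      show fin: "finite (Y n)" by (simp add: Y_def sample_set_def)
      show ne: "Y n \<noteq> {}" using n m by (auto simp: Y_def sample_set_def)
      show "\<bar>\<rho> n x y - dist x y\<bar> < e n" if "x \<in> Y n" "y \<in> Y n" for x y
        using e(2)[OF n that] .
      show "\<exists>x\<in>Y n. dist y x < e n" for y
        using e(3)[OF n, of y] fin ne by (simp add: Min_less_iff)
    qed
    have XY: "X i j \<omega> \<in> Y n" if "i \<in> {1..m}" "j \<in> {1..n}" for i j n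
      unfolding Y_def sample_set_def using that by blast
    have a: "a n i \<in> prob_measures (Y n) (\<rho> n)"
      and emb_a: "distr (a n i) borel (\<lambda>x. x) = dirac_average borel n (\<lambda>j. X i j \<omega>)"
      if n: "1 \<le> n" and i: "i \<in> {1..m}" for n i
    proof -
      interpret finite_metric_approximation "Y n" "\<rho> n" "e n" by (rule approx[OF n])
      show "a n i \<in> prob_measures (Y n) (\<rho> n)"
        unfolding a_def prob_measures_def using XY[OF i] by (auto intro!: prob_space_dirac_average n)
      show "distr (a n i) borel (\<lambda>x. x) = dirac_average borel n (\<lambda>j. X i j \<omega>)"
        unfolding a_def using XY[OF i] by (intro distr_dirac_average[OF n]) (auto intro: inclusion_measurable)
    qed
    interpret metric_approximation "prob_measures UNIV dist" "wasserstein2 dist"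
      "\<lambda>n. prob_measures (Y n) (\<rho> n)" "\<lambda>n. wasserstein2 (\<rho> n)" "\<lambda>n \<nu>. distr \<nu> borel (\<lambda>x. x)" e
    proof (intro metric_approximation.intro X.Metric_space_wasserstein2 metric_approximation_axioms.intro)
      show "\<exists>r \<nu>. strict_mono r \<and> \<nu> \<in> prob_measures UNIV dist \<and> (\<lambda>n. wasserstein2 dist (u (r n)) \<nu>) \<longlonglongrightarrow> 0"
        if "\<And>n. u n \<in> prob_measures UNIV dist" for u :: "nat \<Rightarrow> 'a measure"
        by (rule wasserstein2_seq_compact[where \<mu> = u, OF assms(1) that]) blast
      fix n :: nat assume n: "1 \<le> n"
      interpret finite_metric_approximation "Y n" "\<rho> n" "e n" by (rule approx[OF n])
      show "distr \<nu> borel (\<lambda>x. x) \<in> prob_measures UNIV dist" if "\<nu> \<in> prob_measures (Y n) (\<rho> n)" for \<nu>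
        using embed_in[OF that] by (simp add: embed_def)
      show "\<bar>wasserstein2 (\<rho> n) \<mu> \<nu> - wasserstein2 dist (distr \<mu> borel (\<lambda>x. x)) (distr \<nu> borel (\<lambda>x. x))\<bar> \<le> e n"
        if "\<mu> \<in> prob_measures (Y n) (\<rho> n)" "\<nu> \<in> prob_measures (Y n) (\<rho> n)" for \<mu> \<nu>
        using wasserstein2_embed_le[OF that] wasserstein2_le_embed[OF that] by (simp add: embed_def abs_le_iff)
      show "\<exists>\<nu>\<in>prob_measures (Y n) (\<rho> n). wasserstein2 dist \<beta> (distr \<nu> borel (\<lambda>x. x)) \<le> e n"
        if "\<beta> \<in> prob_measures UNIV dist" for \<beta>
        using embed_dense[OF that] by (simp add: embed_def)
    qed (use e(1) in auto)
    \<comment> \<open>Embedding the empirical measure of the sample space gives the empirical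
      measure on \<open>X\<close> only from sample size 1 on, so the two sequences are compared
      eventually.\<close>
    have lim: "(\<lambda>n. wasserstein2 dist (distr (a n i) borel (\<lambda>x. x)) (\<alpha> i)) \<longlonglongrightarrow> 0" if "i \<in> {1..m}" for i
    proof (rule Lim_transform_eventually)
      show "(\<lambda>n. wasserstein2 dist (dirac_average borel n (\<lambda>j. X i j \<omega>)) (\<alpha> i)) \<longlonglongrightarrow> 0"
        using elim(1) that by blast
      show "\<forall>\<^sub>F n in sequentially. wasserstein2 dist (dirac_average borel n (\<lambda>j. X i j \<omega>)) (\<alpha> i) =
          wasserstein2 dist (distr (a n i) borel (\<lambda>x. x)) (\<alpha> i)"
        using eventually_ge_at_top[of 1] by eventually_elim (use emb_a that in simp)
    qed
    have "\<exists>N. \<forall>n\<ge>N. \<forall>S\<in>wasserstein_barycenter_sets (Y n) (\<rho> n) m (a n) p k.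
        \<exists>S'\<in>wasserstein_barycenter_sets UNIV dist m \<alpha> p k.
          hausdorff_distance (wasserstein2 dist) ((\<lambda>\<nu>. distr \<nu> borel (\<lambda>x. x)) ` S) S' \<le> \<epsilon>"
      if \<epsilon>: "0 < \<epsilon>" for \<epsilon>
    proof -
      \<comment> \<open>The translation to \<open>average_cost_minimizers\<close> requires a
        nonempty sample, which is why the threshold \<open>N\<close> obtained below comes with
        \<open>1 \<le> N\<close>.\<close>
      have eq_n: "wasserstein_barycenter_sets (Y n) (\<rho> n) m (a n) p k
          = average_cost_minimizers (prob_measures (Y n) (\<rho> n)) (wasserstein2 (\<rho> n)) m (a n) p k"
        if "1 \<le> n" for n
      proof -
        interpret finite_metric_approximation "Y n" "\<rho> n" "e n" by (rule approx[OF that])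
        show ?thesis using m a[OF that] by (rule Y.wasserstein_barycenter_sets_eq)
      qed
      have eq: "wasserstein_barycenter_sets UNIV dist m \<alpha> p k
          = average_cost_minimizers (prob_measures UNIV dist) (wasserstein2 dist) m \<alpha> p k"
        using m assms(5) by (rule X.wasserstein_barycenter_sets_eq)
      have "\<exists>N\<ge>1. \<forall>n\<ge>N.
          \<forall>S\<in>average_cost_minimizers (prob_measures (Y n) (\<rho> n)) (wasserstein2 (\<rho> n)) m (a n) p k.
          \<exists>S'\<in>average_cost_minimizers (prob_measures UNIV dist) (wasserstein2 dist) m \<alpha> p k.
          hausdorff_distance (wasserstein2 dist) ((\<lambda>\<nu>. distr \<nu> borel (\<lambda>x. x)) ` S) S' \<le> \<epsilon>"
        using assms(2) p0 m assms(5) a lim \<epsilon> by (rule average_cost_minimizers_converge)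
      then obtain N where N: "1 \<le> N" "\<forall>n\<ge>N.
          \<forall>S\<in>average_cost_minimizers (prob_measures (Y n) (\<rho> n)) (wasserstein2 (\<rho> n)) m (a n) p k.
          \<exists>S'\<in>average_cost_minimizers (prob_measures UNIV dist) (wasserstein2 dist) m \<alpha> p k.
          hausdorff_distance (wasserstein2 dist) ((\<lambda>\<nu>. distr \<nu> borel (\<lambda>x. x)) ` S) S' \<le> \<epsilon>"
        by blast
      show ?thesis
      proof (intro exI[of _ N] allI impI)
        fix n assume n: "N \<le> n"
        then have "1 \<le> n" using N(1) by linarith
        then show "\<forall>S\<in>wasserstein_barycenter_sets (Y n) (\<rho> n) m (a n) p k.
            \<exists>S'\<in>wasserstein_barycenter_sets UNIV dist m \<alpha> p k.
              hausdorff_distance (wasserstein2 dist) ((\<lambda>\<nu>. distr \<nu> borel (\<lambda>x. x)) ` S) S' \<le> \<epsilon>"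
          unfolding eq using N(2) n by (simp add: eq_n)
      qed
    qed
    then show ?case unfolding Y_def \<rho>_def a_def by blast
  qed
qed

end
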